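(* Let $X$ be a locally compact separable metric space and $m$ a Radon measure on $X$ of full support. Let $E$ be a regular energy form on $L^0(m)$ and let $\widetilde E$ be a transient Silverstein extension of $E$. Let $h$ be a strictly positive $\widetilde E$-superharmonic function. The following assertions are equivalent. (i) $E=\widetilde E$. (ii) ${\rm cap}^{\rm top}_{\widetilde E,h}(\partial X)=0$, where ${\rm cap}^{\rm top}_{\widetilde E,h}(\partial X):=\inf\{{\rm cap}_{\widetilde E,h}(X\setminus K): K\subseteq X\text{ compact}\}$.
   Context: $L^0(m)$ is the space of real-valued (Borel) measurable functions modulo $m$-a.e. equality, with the topology $\tau(m)$ of local convergence in measure: $f_i\to f$ iff $\int_U|f_i-f|\wedge1\,dm\to0$ for every measurable $U$ with $m(U)<\infty$. A quadratic form on $L^0(m)$ is a map $q:L^0(m)\to[0,\infty]$ with $2q(u)+2q(v)=q(u+v)+q(u-v)$ and $q(\lambda u)=|\lambda|^2q(u)$ ($0\cdot\infty=0$); $D(q)=\{q<\infty\}$, $\ker q=\{q=0\}$, and $q(u,v)=\frac14(q(u+v)-q(u-v))$ is the induced bilinear form on $D(q)$. The form topology on $D(q)$ is the smallest topology containing the subspace topology of $\tau(m)$ and the topology of the seminorm $q^{1/2}$; $q$ is closed if $D(q)$ is complete in it. $\tilde q$ is an extension of $q$ if $D(q)\subseteq D(\tilde q)$ and $\tilde q=q$ on $D(q)$. An $\varepsilon$-cutoff is a monotone increasing map $C:\mathbb R\to[-\varepsilon,1+\varepsilon]$ with $|C(x)-C(y)|\le|x-y|$ and $C(x)=x$ for $x\in[0,1]$.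 A quadratic form $E$ on $L^0(m)$ is Markovian if for each $\varepsilon>0$ there is an $\varepsilon$-cutoff $C_\varepsilon$ with $E(C_\varepsilon\circ f)\le E(f)$ for all $f\in L^0(m)$; an energy form is a closed Markovian form on $L^0(m)$. It is transient if its kernel is $\{0\}$. It is regular if $D(E)\cap C_c(X)$ is dense in $D(E)$ with respect to the form topology and dense in $C_c(X)$ with respect to uniform convergence. A Silverstein extension of an energy form $E$ is an energy form $\widetilde E$ on $L^0(m)$ extending $E$ such that $fg\in D(E)$ for all $f\in D(E)\cap L^\infty(m)$, $g\in D(\widetilde E)\cap L^\infty(m)$ (equivalently, $f\in D(E)$, $g\in D(\widetilde E)$, $|g|\le|f|$ imply $g\in D(E)$). $h\in D(\widetilde E)$ is $\widetilde E$-superharmonic if $\widetilde E(h,\psi)\ge0$ for all nonnegative $\psi\in D(\widetilde E)$; strictly positive means $h>0$ $m$-a.e. For measurable $U$, ${\rm cap}_{\widetilde E,h}(U)=\inf\{\widetilde E(f): f\in L^0(m),\ f1_U\ge h1_U\}$. *)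

theory Defs
  imports "HOL-Analysis.Analysis"
begin

section \<open>The space of measurable functions and local convergence in measure\<close>

text \<open>
  Elements of \<open>L\<^sup>0(m)\<close> are handled through representatives: real-valued Borel functions, where
  two functions that agree \<open>m\<close>-almost everywhere stand for the same element. Maps on
  \<open>L\<^sup>0(m)\<close> are maps on representatives that respect almost everywhere equality (part of
  \<open>quadratic_form\<close> below), and all topologies below have only open sets that are
  saturated for almost everywhere equality.
\<close>

definition L0 :: "'a measure \<Rightarrow> ('a \<Rightarrow> real) set" where
  "L0 m = borel_measurable m"

definition Linf :: "'a measure \<Rightarrow> ('a \<Rightarrow> real) set" where
  "Linf m = {f \<in> L0 m. \<exists>c. AE x in m. \<bar>f x\<bar> \<le> c}"

definition loc_dist :: "'a measure \<Rightarrow> 'a set \<Rightarrow> ('a \<Rightarrow> real) \<Rightarrow> ('a \<Rightarrow> real) \<Rightarrow> ennreal" where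
  "loc_dist m U f g = (\<integral>\<^sup>+x\<in>U. ennreal (min \<bar>f x - g x\<bar> 1) \<partial>m)"

definition tau :: "'a measure \<Rightarrow> ('a \<Rightarrow> real) topology" where
  "tau m = topology_generated_by
     {{g \<in> L0 m. loc_dist m U g f < e} | f U e.
        f \<in> L0 m \<and> U \<in> sets m \<and> emeasure m U < \<infinity> \<and> 0 < e}"

lemma loc_dist_self [simp]: "loc_dist m U f f = 0"
  by (simp add: loc_dist_def)

lemma openin_tau_ball:
  assumes "f \<in> L0 m" "U \<in> sets m" "emeasure m U < \<infinity>" "0 < e"
  shows "openin (tau m) {g \<in> L0 m. loc_dist m U g f < e}"
  unfolding tau_def
proof (rule topology_generated_by_Basis, rule CollectI)
  show "\<exists>f' U' e'. {g \<in> L0 m. loc_dist m U g f < e} = {g \<in> L0 m. loc_dist m U' g f' < e'} \<and>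
      f' \<in> L0 m \<and> U' \<in> sets m \<and> emeasure m U' < \<infinity> \<and> 0 < e'"
    by (rule exI[of _ f], rule exI[of _ U], rule exI[of _ e]) (simp add: assms[simplified])
qed

lemma topspace_tau [simp]: "topspace (tau m) = L0 m"
proof
  show "topspace (tau m) \<subseteq> L0 m"
    unfolding tau_def topology_generated_by_topspace by (rule Union_least) clarify
  show "L0 m \<subseteq> topspace (tau m)"
  proof
    fix f assume f: "f \<in> L0 m"
    have "openin (tau m) {g \<in> L0 m. loc_dist m {} g f < 1}"
      by (rule openin_tau_ball) (simp_all add: f)
    from openin_subset[OF this] show "f \<in> topspace (tau m)"
      by (rule subsetD) (simp add: f)
  qed
qed

lemma loc_dist_triangle:
  assumes "f \<in> L0 m" "g \<in> L0 m" "k \<in> L0 m" "U \<in> sets m"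
  shows "loc_dist m U f k \<le> loc_dist m U f g + loc_dist m U g k"
proof -
  note [measurable] = assms[unfolded L0_def]
  have "loc_dist m U f k \<le> (\<integral>\<^sup>+x. (ennreal (min \<bar>f x - g x\<bar> 1) * indicator U x
      + ennreal (min \<bar>g x - k x\<bar> 1) * indicator U x) \<partial>m)"
    unfolding loc_dist_def
  proof (rule nn_integral_mono)
    fix x
    have "ennreal (min \<bar>f x - k x\<bar> 1) \<le> ennreal (min (\<bar>f x - g x\<bar>) 1 + min (\<bar>g x - k x\<bar>) 1)"
      by (intro ennreal_leI) linarith
    then show "ennreal (min \<bar>f x - k x\<bar> 1) * indicator U x
      \<le> ennreal (min \<bar>f x - g x\<bar> 1) * indicator U x
        + ennreal (min \<bar>g x - k x\<bar> 1) * indicator U x"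
      by (auto simp: indicator_def)
  qed
  also have "\<dots> = loc_dist m U f g + loc_dist m U g k"
    unfolding loc_dist_def by (rule nn_integral_add) measurable
  finally show ?thesis .
qed

text \<open>Convergence in this topology, along arbitrary nets, is local convergence in measure.\<close>

lemma limitin_tau_iff:
  assumes "\<And>i. f i \<in> L0 m"
  shows "limitin (tau m) f g F \<longleftrightarrow> g \<in> L0 m \<and>
    (\<forall>U\<in>sets m. emeasure m U < \<infinity> \<longrightarrow>
       ((\<lambda>i. \<integral>\<^sup>+x\<in>U. ennreal (min \<bar>f i x - g x\<bar> 1) \<partial>m) \<longlongrightarrow> 0) F)"
    (is "?L \<longleftrightarrow> ?R")
proof
  assume L: ?L
  then have g: "g \<in> L0 m"
    using limitin_topspace[of "tau m" f g F] by simp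
  have "((\<lambda>i. loc_dist m U (f i) g) \<longlongrightarrow> 0) F" if U: "U \<in> sets m" "emeasure m U < \<infinity>" for U
  proof (rule order_tendstoI)
    fix e :: ennreal assume e: "0 < e"
    have "openin (tau m) {k \<in> L0 m. loc_dist m U k g < e}"
      by (rule openin_tau_ball[OF g U e])
    then show "eventually (\<lambda>i. loc_dist m U (f i) g < e) F"
      using limitinD[OF L, of "{k \<in> L0 m. loc_dist m U k g < e}"] g e
      by (simp add: eventually_conj_iff)
  qed auto
  then show ?R
    using g by (simp add: loc_dist_def)
next
  assume R: ?R
  then have g: "g \<in> L0 m" by blast
  have *: "eventually (\<lambda>i. f i \<in> W) F"
    if "generate_topology_on {{g \<in> L0 m. loc_dist m U g f < e} | f U e.
        f \<in> L0 m \<and> U \<in> sets m \<and> emeasure m U < \<infinity> \<and> 0 < e} W" "g \<in> W" for W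
    using that
  proof (induction W rule: generate_topology_on.induct)
    case (Int A B)
    then show ?case by (simp add: eventually_conj)
  next
    case (UN K)
    then obtain A where "A \<in> K" "g \<in> A" by blast
    then have "eventually (\<lambda>i. f i \<in> A) F"
      using UN.IH by simp
    then show ?case
      by (rule eventually_mono) (use \<open>A \<in> K\<close> in blast)
  next
    case (Basis W)
    then obtain k U e where W: "W = {g \<in> L0 m. loc_dist m U g k < e}" "k \<in> L0 m"
      "U \<in> sets m" "emeasure m U < \<infinity>" by blast
    have lt: "loc_dist m U g k < e" using \<open>g \<in> W\<close> W(1) by simp
    have "((\<lambda>i. loc_dist m U (f i) g) \<longlongrightarrow> 0) F"
      using R W by (simp add: loc_dist_def)
    then have "((\<lambda>i. loc_dist m U (f i) g + loc_dist m U g k) \<longlongrightarrow> 0 + loc_dist m U g k) F"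
      by (rule tendsto_add) (rule tendsto_const)
    then have "eventually (\<lambda>i. loc_dist m U (f i) g + loc_dist m U g k < e) F"
      using lt by (simp add: order_tendstoD(2))
    then show ?case
    proof (rule eventually_mono)
      fix i assume "loc_dist m U (f i) g + loc_dist m U g k < e"
      then have "loc_dist m U (f i) k < e"
        using W assms g by (simp add: le_less_trans[OF loc_dist_triangle[of "f i" m g k U]])
      then show "f i \<in> W"
        using W assms by simp
    qed
  qed simp
  show ?L
    unfolding limitin_def topspace_tau
  proof (intro conjI allI impI)
    fix W assume "openin (tau m) W \<and> g \<in> W"
    then show "eventually (\<lambda>i. f i \<in> W) F"
      by (intro *) (simp_all add: tau_def openin_topology_generated_by_iff)
  qed (rule g)
qed


section \<open>Quadratic forms and energy forms\<close>

definition quadratic_form :: "'a measure \<Rightarrow> (('a \<Rightarrow> real) \<Rightarrow> ennreal) \<Rightarrow> bool" where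
  "quadratic_form m q \<longleftrightarrow>
     (\<forall>u\<in>L0 m. \<forall>v\<in>L0 m. (AE x in m. u x = v x) \<longrightarrow> q u = q v) \<and>
     (\<forall>u\<in>L0 m. \<forall>v\<in>L0 m. 2 * q u + 2 * q v = q (\<lambda>x. u x + v x) + q (\<lambda>x. u x - v x)) \<and>
     (\<forall>u\<in>L0 m. \<forall>c::real. q (\<lambda>x. c * u x) = ennreal (\<bar>c\<bar>\<^sup>2) * q u)"

definition form_dom :: "'a measure \<Rightarrow> (('a \<Rightarrow> real) \<Rightarrow> ennreal) \<Rightarrow> ('a \<Rightarrow> real) set" where
  "form_dom m q = {u \<in> L0 m. q u < \<infinity>}"

definition form_ker :: "'a measure \<Rightarrow> (('a \<Rightarrow> real) \<Rightarrow> ennreal) \<Rightarrow> ('a \<Rightarrow> real) set" where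
  "form_ker m q = {u \<in> L0 m. q u = 0}"

text \<open>Only meaningful for \<open>u\<close> and \<open>v\<close> in the domain of \<open>q\<close>.\<close>

definition bilin :: "(('a \<Rightarrow> real) \<Rightarrow> ennreal) \<Rightarrow> ('a \<Rightarrow> real) \<Rightarrow> ('a \<Rightarrow> real) \<Rightarrow> real" where
  "bilin q u v = (enn2real (q (\<lambda>x. u x + v x)) - enn2real (q (\<lambda>x. u x - v x))) / 4"

definition seminorm_topology ::
    "'a measure \<Rightarrow> (('a \<Rightarrow> real) \<Rightarrow> ennreal) \<Rightarrow> ('a \<Rightarrow> real) topology" where
  "seminorm_topology m q = topology_generated_by
     {{g \<in> form_dom m q. sqrt (enn2real (q (\<lambda>x. g x - f x))) < e} | f e.
        f \<in> form_dom m q \<and> 0 < e}"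

definition form_topology ::
    "'a measure \<Rightarrow> (('a \<Rightarrow> real) \<Rightarrow> ennreal) \<Rightarrow> ('a \<Rightarrow> real) topology" where
  "form_topology m q = topology_generated_by
     ({W. openin (subtopology (tau m) (form_dom m q)) W} \<union> {W. openin (seminorm_topology m q) W})"

text \<open>
  Completeness is that of a topological vector space: every Cauchy filter converges, where
  being Cauchy refers to the translation invariant uniformity given by the neighbourhoods of \<open>0\<close>.
\<close>

definition form_cauchy ::
    "'a measure \<Rightarrow> (('a \<Rightarrow> real) \<Rightarrow> ennreal) \<Rightarrow> ('a \<Rightarrow> real) filter \<Rightarrow> bool" where
  "form_cauchy m q F \<longleftrightarrow>
     (\<forall>N. openin (form_topology m q) N \<and> (\<lambda>x. 0) \<in> N \<longrightarrow>
        (\<forall>\<^sub>F (f, g) in F \<times>\<^sub>F F. (\<lambda>x. f x - g x) \<in> N))"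

definition closed_form :: "'a measure \<Rightarrow> (('a \<Rightarrow> real) \<Rightarrow> ennreal) \<Rightarrow> bool" where
  "closed_form m q \<longleftrightarrow>
     (\<forall>F. F \<noteq> bot \<and> F \<le> principal (form_dom m q) \<and> form_cauchy m q F \<longrightarrow>
        (\<exists>f. limitin (form_topology m q) (\<lambda>g. g) f F))"

definition extends :: "'a measure \<Rightarrow> (('a \<Rightarrow> real) \<Rightarrow> ennreal) \<Rightarrow> (('a \<Rightarrow> real) \<Rightarrow> ennreal) \<Rightarrow> bool" where
  "extends m q' q \<longleftrightarrow>
     form_dom m q \<subseteq> form_dom m q' \<and> (\<forall>u\<in>form_dom m q. q' u = q u)"

definition cutoff :: "real \<Rightarrow> (real \<Rightarrow> real) \<Rightarrow> bool" where
  "cutoff e C \<longleftrightarrow>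
     mono C \<and> range C \<subseteq> {- e..1 + e} \<and> (\<forall>x y. \<bar>C x - C y\<bar> \<le> \<bar>x - y\<bar>) \<and> (\<forall>x\<in>{0..1}. C x = x)"

definition markovian :: "'a measure \<Rightarrow> (('a \<Rightarrow> real) \<Rightarrow> ennreal) \<Rightarrow> bool" where
  "markovian m E \<longleftrightarrow> (\<forall>e>0. \<exists>C. cutoff e C \<and> (\<forall>f\<in>L0 m. E (C \<circ> f) \<le> E f))"

definition energy_form :: "'a measure \<Rightarrow> (('a \<Rightarrow> real) \<Rightarrow> ennreal) \<Rightarrow> bool" where
  "energy_form m E \<longleftrightarrow> quadratic_form m E \<and> closed_form m E \<and> markovian m E"

definition transient :: "'a measure \<Rightarrow> (('a \<Rightarrow> real) \<Rightarrow> ennreal) \<Rightarrow> bool" where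
  "transient m E \<longleftrightarrow> form_ker m E = {u \<in> L0 m. AE x in m. u x = 0}"

definition silverstein_extension ::
    "'a measure \<Rightarrow> (('a \<Rightarrow> real) \<Rightarrow> ennreal) \<Rightarrow> (('a \<Rightarrow> real) \<Rightarrow> ennreal) \<Rightarrow> bool" where
  "silverstein_extension m E E' \<longleftrightarrow>
     energy_form m E' \<and> extends m E' E \<and>
     (\<forall>f\<in>form_dom m E \<inter> Linf m. \<forall>g\<in>form_dom m E' \<inter> Linf m. (\<lambda>x. f x * g x) \<in> form_dom m E)"

definition superharmonic :: "'a measure \<Rightarrow> (('a \<Rightarrow> real) \<Rightarrow> ennreal) \<Rightarrow> ('a \<Rightarrow> real) \<Rightarrow> bool" where
  "superharmonic m E h \<longleftrightarrow>
     h \<in> form_dom m E \<and> (\<forall>\<psi>\<in>form_dom m E. (AE x in m. 0 \<le> \<psi> x) \<longrightarrow> 0 \<le> bilin E h \<psi>)"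


section \<open>Regularity and capacity\<close>

definition radon_measure :: "'a::topological_space measure \<Rightarrow> bool" where
  "radon_measure m \<longleftrightarrow>
     sets m = sets borel \<and>
     (\<forall>K. compact K \<longrightarrow> emeasure m K < \<infinity>) \<and>
     (\<forall>B\<in>sets borel. emeasure m B = (SUP K\<in>{K. compact K \<and> K \<in> sets borel \<and> K \<subseteq> B}. emeasure m K))"

definition full_support :: "'a::topological_space measure \<Rightarrow> bool" where
  "full_support m \<longleftrightarrow> (\<forall>U. open U \<and> U \<noteq> {} \<longrightarrow> 0 < emeasure m U)"

definition Cc :: "('a::topological_space \<Rightarrow> real) set" where
  "Cc = {f. continuous_on UNIV f \<and> compact (closure {x. f x \<noteq> 0})}"

definition regular_form :: "'a::topological_space measure \<Rightarrow> (('a \<Rightarrow> real) \<Rightarrow> ennreal) \<Rightarrow> bool" where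
  "regular_form m E \<longleftrightarrow>
     form_topology m E closure_of (form_dom m E \<inter> Cc) = form_dom m E \<and>
     (\<forall>f\<in>Cc. \<forall>e>0. \<exists>g\<in>form_dom m E \<inter> Cc. \<forall>x. \<bar>g x - f x\<bar> < e)"

definition cap ::
    "'a measure \<Rightarrow> (('a \<Rightarrow> real) \<Rightarrow> ennreal) \<Rightarrow> ('a \<Rightarrow> real) \<Rightarrow> 'a set \<Rightarrow> ennreal" where
  "cap m E h U = Inf {E f | f. f \<in> L0 m \<and> (AE x in m. f x * indicator U x \<ge> h x * indicator U x)}"

definition cap_top_boundary ::
    "'a::topological_space measure \<Rightarrow> (('a \<Rightarrow> real) \<Rightarrow> ennreal) \<Rightarrow> ('a \<Rightarrow> real) \<Rightarrow> ennreal" where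
  "cap_top_boundary m E h = (INF K\<in>{K. compact K}. cap m E h (UNIV - K))"

end

theory Submission
  imports Defs
begin

text \<open>
  If \<open>E = E'\<close>, regularity approximates \<open>h\<close> in the form topology by \<open>\<phi> \<in> C\<^sub>c(X)\<close>, and
  \<open>h - \<phi>\<close> competes in the capacity of the complement of the support of \<open>\<phi>\<close>.

  Conversely, zero capacity yields compact sets \<open>K\<^sub>n\<close> and functions \<open>f\<^sub>n\<close> with
  \<open>E'(f\<^sub>n) \<le> 4\<^sup>-\<^sup>n\<close> that dominate \<open>h\<close> off \<open>K\<^sub>n\<close>; superharmonicity allows truncating them at
  \<open>h\<close>. Since \<open>E'(min u v) \<le> E'(u) + E'(v)\<close>, lower semicontinuity shows that
  \<open>lim inf f\<^sub>n\<close> has energy \<open>0\<close> and hence vanishes by transience, so the running minima \<open>w\<^sub>j\<close> of the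
  \<open>f\<^sub>n\<close> tend to \<open>0\<close> almost everywhere with bounded energy. For \<open>0 \<le> g \<le> min c (c h)\<close> in the
  domain of \<open>E'\<close> the functions \<open>(g - c w\<^sub>j)\<^sup>+\<close> are bounded with compact support, hence lie in the
  domain of \<open>E\<close> by the ideal property, and converge to \<open>g\<close> with bounded energy. Lower
  semicontinuity of \<open>E\<close> puts \<open>g\<close> into its domain, and truncation by multiples of \<open>h\<close> extends this to
  all \<open>g\<close>.
\<close>

section \<open>Quadratic forms and the form topology\<close>

locale quadratic_form_L0 =
  fixes m :: "'a measure" and E :: "('a \<Rightarrow> real) \<Rightarrow> ennreal"
  assumes quadratic_form: "quadratic_form m E"
begin

abbreviation "D \<equiv> form_dom m E"
text \<open>\<open>enn2real\<close> sends infinite energy to 0, so \<open>Q\<close> measures energy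
  only on \<open>D\<close>.\<close>

abbreviation "Q u \<equiv> enn2real (E u)"
abbreviation "B \<equiv> bilin E"

lemma cong_AE: "u \<in> L0 m \<Longrightarrow> v \<in> L0 m \<Longrightarrow> AE x in m. u x = v x \<Longrightarrow> E u = E v"
  by (rule quadratic_form[unfolded quadratic_form_def, THEN conjunct1, rule_format])

lemma parallelogram:
  "u \<in> L0 m \<Longrightarrow> v \<in> L0 m \<Longrightarrow> 2 * E u + 2 * E v = E (\<lambda>x. u x + v x) + E (\<lambda>x. u x - v x)"
  by (rule quadratic_form[unfolded quadratic_form_def, THEN conjunct2, THEN conjunct1, rule_format])

lemma scale: "u \<in> L0 m \<Longrightarrow> E (\<lambda>x. c * u x) = ennreal (c\<^sup>2) * E u"
  using quadratic_form[unfolded quadratic_form_def, THEN conjunct2, THEN conjunct2, rule_format, of u c]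
  by simp

lemma dom_L0: "u \<in> D \<Longrightarrow> u \<in> L0 m"
  by (simp add: form_dom_def)

lemma dom_cong_AE: "u \<in> D \<Longrightarrow> v \<in> L0 m \<Longrightarrow> AE x in m. u x = v x \<Longrightarrow> v \<in> D"
  using cong_AE[of u v] by (simp add: form_dom_def)

lemma E_eq_Q: "u \<in> D \<Longrightarrow> E u = ennreal (Q u)"
  by (simp add: form_dom_def)

lemma E_le_iff: "u \<in> D \<Longrightarrow> 0 \<le> c \<Longrightarrow> E u \<le> ennreal c \<longleftrightarrow> Q u \<le> c"
  by (subst E_eq_Q) simp_all

lemma domI: "u \<in> L0 m \<Longrightarrow> E u \<le> ennreal c \<Longrightarrow> u \<in> D"
  using le_less_trans[of "E u" "ennreal c" top] by (simp add: form_dom_def)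

lemma add_le: "u \<in> L0 m \<Longrightarrow> v \<in> L0 m \<Longrightarrow> E (\<lambda>x. u x + v x) \<le> 2 * E u + 2 * E v"
  using parallelogram[of u v] by simp

lemma dom_add: assumes "u \<in> D" "v \<in> D" shows "(\<lambda>x. u x + v x) \<in> D"
proof -
  have "E (\<lambda>x. u x + v x) \<le> 2 * E u + 2 * E v"
    using assms by (intro add_le dom_L0)
  also have "\<dots> < \<infinity>"
    using assms by (auto simp: form_dom_def ennreal_mult_less_top)
  finally show ?thesis
    using assms by (auto simp: form_dom_def L0_def)
qed

lemma dom_scale: "u \<in> D \<Longrightarrow> (\<lambda>x. c * u x) \<in> D"
  using scale[of u c] by (auto simp: form_dom_def L0_def ennreal_mult_less_top)

lemma dom_diff: "u \<in> D \<Longrightarrow> v \<in> D \<Longrightarrow> (\<lambda>x. u x - v x) \<in> D"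
  using dom_add[OF _ dom_scale, of u v "-1"] by simp

lemma dom_zero: "(\<lambda>x. 0) \<in> D"
  using scale[of "\<lambda>x. 0" 0] by (simp add: form_dom_def L0_def)

lemma Q_parallelogram:
  assumes "u \<in> D" "v \<in> D"
  shows "2 * Q u + 2 * Q v = Q (\<lambda>x. u x + v x) + Q (\<lambda>x. u x - v x)"
proof -
  have "enn2real (2 * E u + 2 * E v) = enn2real (E (\<lambda>x. u x + v x) + E (\<lambda>x. u x - v x))"
    using assms by (simp add: parallelogram dom_L0)
  then show ?thesis
    using assms dom_add[OF assms] dom_diff[OF assms]
    by (simp add: form_dom_def enn2real_plus enn2real_mult ennreal_mult_less_top)
qed

lemma Q_scale: "u \<in> D \<Longrightarrow> Q (\<lambda>x. c * u x) = c\<^sup>2 * Q u"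
  by (simp add: scale dom_L0 enn2real_mult)

lemma Q_minus: "u \<in> D \<Longrightarrow> Q (\<lambda>x. - u x) = Q u"
  using Q_scale[of u "-1"] by simp

lemma Q_minus_commute: "u \<in> D \<Longrightarrow> v \<in> D \<Longrightarrow> Q (\<lambda>x. u x - v x) = Q (\<lambda>x. v x - u x)"
  using Q_minus[OF dom_diff, of u v] by simp

section \<open>The bilinear form obtained by polarization\<close>

lemma four_B: "4 * B u v = Q (\<lambda>x. u x + v x) - Q (\<lambda>x. u x - v x)"
  by (simp add: bilin_def)

lemma Q_add: "u \<in> D \<Longrightarrow> v \<in> D \<Longrightarrow> Q (\<lambda>x. u x + v x) = Q u + Q v + 2 * B u v"
  using Q_parallelogram[of u v] four_B[of u v] by linarith

lemma Q_diff: "u \<in> D \<Longrightarrow> v \<in> D \<Longrightarrow> Q (\<lambda>x. u x - v x) = Q u + Q v - 2 * B u v"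
  using Q_parallelogram[of u v] four_B[of u v] by linarith

lemma B_commute: "u \<in> D \<Longrightarrow> v \<in> D \<Longrightarrow> B u v = B v u"
  using Q_minus_commute[of u v] by (simp add: bilin_def add.commute)

lemma B_minus_left: "u \<in> D \<Longrightarrow> w \<in> D \<Longrightarrow> B (\<lambda>x. - u x) w = - B u w"
  using Q_minus[OF dom_add, of u w] Q_minus_commute[of w u] four_B[of u w]
    four_B[of "\<lambda>x. - u x" w]
  by (simp add: add.commute)

text \<open>Jordan and von Neumann: the parallelogram law applied to \<open>u \<plusminus> w\<close> and \<open>v\<close>.\<close>
lemma B_add_left:
  assumes "u \<in> D" "v \<in> D" "w \<in> D"
  shows "B (\<lambda>x. u x + v x) w = B u w + B v w"
proof -
  have *: "B (\<lambda>x. u x + v x) w + B (\<lambda>x. u x - v x) w = 2 * B u w"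
    if "u \<in> D" "v \<in> D" for u v
  proof -
    have eq: "(\<lambda>x. u x + w x + v x) = (\<lambda>x. u x + v x + w x)"
      "(\<lambda>x. u x + w x - v x) = (\<lambda>x. u x - v x + w x)"
      "(\<lambda>x. u x - w x + v x) = (\<lambda>x. u x + v x - w x)"
      "(\<lambda>x. u x - w x - v x) = (\<lambda>x. u x - v x - w x)"
      by (auto simp: fun_eq_iff)
    show ?thesis
      using Q_parallelogram[OF dom_add[OF that(1) assms(3)] that(2)]
        Q_parallelogram[OF dom_diff[OF that(1) assms(3)] that(2)]
        four_B[of "\<lambda>x. u x + v x" w] four_B[of "\<lambda>x. u x - v x" w] four_B[of u w]
      unfolding eq by linarith
  qed
  have "B (\<lambda>x. v x - u x) w = - B (\<lambda>x. u x - v x) w"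
    using B_minus_left[OF dom_diff[of u v] assms(3)] assms by simp
  then show ?thesis
    using *[of u v] *[of v u] assms by (simp add: add.commute[of "v _" "u _"])
qed

text \<open>Additivity gives natural factors by induction; applied to \<open>u / n\<close> this also
  yields factors \<open>1 / n\<close>.\<close>

lemma B_of_nat_left:
  assumes "u \<in> D" "w \<in> D"
  shows "B (\<lambda>x. of_nat n * u x) w = of_nat n * B u w"
proof (induction n)
  case 0
  \<comment> \<open>\<open>B 0 w\<close> is a quarter of the difference of \<open>Q w\<close> and
    \<open>Q (- w)\<close>, which agree.\<close>
  then show ?case
    using Q_minus[OF assms(2)] by (simp add: bilin_def)
next
  case (Suc n)
  then show ?case
    using B_add_left[OF assms(1) dom_scale[OF assms(1), of "of_nat n"] assms(2)]
    by (simp add: distrib_right)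
qed

lemma B_divide_of_nat:
  assumes "u \<in> D" "w \<in> D" "n > 0"
  shows "B u w = of_nat n * B (\<lambda>x. (1 / of_nat n) * u x) w"
  using B_of_nat_left[OF dom_scale[OF assms(1), of "1 / of_nat n"] assms(2), of n] assms(3)
  by simp

lemma two_B_le: "u \<in> D \<Longrightarrow> v \<in> D \<Longrightarrow> 2 * B u v \<le> Q u + Q v"
  using Q_diff[of u v] enn2real_nonneg[of "E (\<lambda>x. u x - v x)"] by linarith

text \<open>The splitting \<open>B u v = B (u / n) (n v)\<close> replaces the Cauchy-Schwarz inequality.\<close>
lemma Q_add_le:
  assumes "u \<in> D" "v \<in> D" "n > 0"
  shows "Q (\<lambda>x. u x + v x) \<le> (1 + 1 / real n) * Q u + (1 + real n ^ 3) * Q v"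
proof -
  have "2 * B u v = real n * (2 * B (\<lambda>x. (1 / real n) * u x) v)"
    using B_divide_of_nat[OF assms] by simp
  also have "\<dots> = 2 * B (\<lambda>x. real n * v x) (\<lambda>x. (1 / real n) * u x)"
    using B_of_nat_left[OF assms(2) dom_scale[OF assms(1)], of n "1 / real n"]
      B_commute[OF assms(2) dom_scale[OF assms(1), of "1 / real n"]] by simp
  also have "\<dots> \<le> Q (\<lambda>x. real n * v x) + Q (\<lambda>x. (1 / real n) * u x)"
    using assms by (intro two_B_le dom_scale)
  also have "\<dots> = real n ^ 2 * Q v + (1 / real n) ^ 2 * Q u"
    using assms by (simp only: Q_scale)
  \<comment> \<open>For \<open>n \<ge> 1\<close> both coefficients may be enlarged to those of the
    statement; the total factor of \<open>Q u\<close> still tends to 1.\<close>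
  also have "\<dots> \<le> real n ^ 3 * Q v + 1 / real n * Q u"
  proof (intro add_mono mult_right_mono)
    show "(real n)\<^sup>2 \<le> real n ^ 3"
      using assms by (intro power_increasing) auto
    show "(1 / real n)\<^sup>2 \<le> 1 / real n"
      using assms by (simp add: power2_eq_square divide_simps)
  qed auto
  finally show ?thesis
    using Q_add[OF assms(1,2)] unfolding distrib_right by linarith
qed

text \<open>First \<open>n\<close> is chosen so that \<open>(1 + 1 / n) * Q u\<close> stays below
  \<open>e\<close>; for this fixed \<open>n\<close> the term with \<open>Q (v i)\<close> vanishes in
  the limit. This handles seminorm balls not centred at 0.\<close>

lemma Q_add_null:
  assumes v: "\<And>i. v i \<in> D" "((\<lambda>i. Q (v i)) \<longlongrightarrow> 0) F" and u: "u \<in> D" "Q u < e"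
  shows "eventually (\<lambda>i. Q (\<lambda>x. u x + v i x) < e) F"
proof -
  have "(\<lambda>n. (1 + 1 / real (Suc n)) * Q u) \<longlonglongrightarrow> (1 + 0) * Q u"
    by (intro tendsto_intros LIMSEQ_Suc lim_1_over_n)
  then have "eventually (\<lambda>n. (1 + 1 / real (Suc n)) * Q u < e) sequentially"
    using u by (intro order_tendstoD(2)) auto
  then obtain n where n: "(1 + 1 / real (Suc n)) * Q u < e"
    by (auto simp: eventually_sequentially)
  have "((\<lambda>i. (1 + 1 / real (Suc n)) * Q u + (1 + real (Suc n) ^ 3) * Q (v i))
      \<longlongrightarrow> (1 + 1 / real (Suc n)) * Q u + (1 + real (Suc n) ^ 3) * 0) F"
    by (intro tendsto_intros v)
  then have "eventually (\<lambda>i. (1 + 1 / real (Suc n)) * Q u + (1 + real (Suc n) ^ 3) * Q (v i) < e) F"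
    using n by (intro order_tendstoD(2)) auto
  then show ?thesis
    by (rule eventually_mono) (rule le_less_trans[OF Q_add_le[OF u(1) v(1), of "Suc n"]], simp_all)
qed

section \<open>Neighbourhoods and limits in the form topology\<close>

lemma openin_seminorm_ball:
  assumes "f \<in> D" "0 < e"
  shows "openin (form_topology m E) {g \<in> D. sqrt (Q (\<lambda>x. g x - f x)) < e}"
proof -
  have "openin (seminorm_topology m E) {g \<in> D. sqrt (Q (\<lambda>x. g x - f x)) < e}"
    unfolding seminorm_topology_def using assms by (intro topology_generated_by_Basis) blast
  then show ?thesis
    unfolding form_topology_def by (intro topology_generated_by_Basis) blast
qed

lemma openin_form_tau:
  assumes "openin (tau m) W"
  shows "openin (form_topology m E) (W \<inter> D)"
  unfolding form_topology_def using assms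
  by (intro topology_generated_by_Basis) (auto simp: openin_subtopology)

lemma topspace_form_topology: "topspace (form_topology m E) = D"
proof
  have "topspace (seminorm_topology m E) \<subseteq> D"
    unfolding seminorm_topology_def topology_generated_by_topspace by (rule Union_least) clarify
  then have "W \<subseteq> D" if "openin (seminorm_topology m E) W" for W
    using openin_subset[OF that] by (rule subset_trans[rotated])
  moreover have "W \<subseteq> D" if "openin (subtopology (tau m) D) W" for W
    using openin_subset[OF that] by simp
  ultimately show "topspace (form_topology m E) \<subseteq> D"
    unfolding form_topology_def topology_generated_by_topspace
    by (intro Union_least) (elim UnE CollectE, simp_all)
  show "D \<subseteq> topspace (form_topology m E)"
    using openin_subset[OF openin_form_tau[OF openin_topspace]] dom_L0 by auto
qed

text \<open>Induction over generated open sets, once for the seminorm topology and once for its join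
  with \<open>tau m\<close>. The limit 0 is the one at which Cauchy filters are tested.\<close>

lemma limitin_form_topology_zero:
  assumes v: "\<And>i. v i \<in> D" "((\<lambda>i. Q (v i)) \<longlongrightarrow> 0) F"
    and tau: "limitin (tau m) v (\<lambda>x. 0) F"
  shows "limitin (form_topology m E) v (\<lambda>x. 0) F"
proof -
  have semi: "eventually (\<lambda>i. v i \<in> W) F"
    if "generate_topology_on {{g \<in> D. sqrt (Q (\<lambda>x. g x - f x)) < e} | f e. f \<in> D \<and> 0 < e} W"
      "(\<lambda>x. 0) \<in> W" for W
    using that
  proof (induction W rule: generate_topology_on.induct)
    case (Int A B)
    then show ?case by (simp add: eventually_conj)
  next
    case (UN K)
    then obtain A where "A \<in> K" "(\<lambda>x. 0) \<in> A" by blast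
    then have "eventually (\<lambda>i. v i \<in> A) F"
      using UN.IH by simp
    then show ?case
      by (rule eventually_mono) (use \<open>A \<in> K\<close> in blast)
  next
    case (Basis W)
    then obtain f e where W: "W = {g \<in> D. sqrt (Q (\<lambda>x. g x - f x)) < e}" "f \<in> D" "0 < e"
      by blast
    \<comment> \<open>The ball has an arbitrary centre \<open>f\<close>; that it contains 0 is a
      strict bound on \<open>Q (- f)\<close>, which is stable under adding
      \<open>v i\<close>.\<close>
    have f: "(\<lambda>x. - f x) \<in> D"
      using dom_scale[OF W(2), of "-1"] by simp
    have "sqrt (Q (\<lambda>x. - f x)) < e"
      using Basis(2) W by simp
    then have "Q (\<lambda>x. - f x) < e\<^sup>2"
      using W(3) real_sqrt_less_iff[of "Q (\<lambda>x. - f x)" "e\<^sup>2"] by simp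
    then have "eventually (\<lambda>i. Q (\<lambda>x. - f x + v i x) < e\<^sup>2) F"
      by (intro Q_add_null v f)
    then show ?case
    proof (rule eventually_mono)
      fix i assume "Q (\<lambda>x. - f x + v i x) < e\<^sup>2"
      then have "sqrt (Q (\<lambda>x. v i x - f x)) < sqrt (e\<^sup>2)"
        by (intro real_sqrt_less_mono) simp
      then show "v i \<in> W"
        using W v by simp
    qed
  qed simp
  have "eventually (\<lambda>i. v i \<in> W) F"
    if "generate_topology_on ({W. openin (subtopology (tau m) D) W} \<union>
      {W. openin (seminorm_topology m E) W}) W" "(\<lambda>x. 0) \<in> W" for W
    using that
  proof (induction W rule: generate_topology_on.induct)
    case (Int A B)
    then show ?case by (simp add: eventually_conj)
  next
    case (UN K)
    then obtain A where "A \<in> K" "(\<lambda>x. 0) \<in> A" by blast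
    then have "eventually (\<lambda>i. v i \<in> A) F"
      using UN.IH by simp
    then show ?case
      by (rule eventually_mono) (use \<open>A \<in> K\<close> in blast)
  next
    case (Basis W)
    show ?case
    proof (cases "openin (seminorm_topology m E) W")
      case True
      then show ?thesis
        using Basis(2)
        by (intro semi) (simp_all add: seminorm_topology_def openin_topology_generated_by_iff)
    next
      case False
      then obtain T where T: "openin (tau m) T" "W = T \<inter> D"
        using Basis(1) by (auto simp: openin_subtopology)
      then have "eventually (\<lambda>i. v i \<in> T) F"
        using Basis(2) tau by (auto simp: limitin_def)
      then show ?thesis
        by (rule eventually_mono) (simp add: T v)
    qed
  qed simp
  then show ?thesis
    unfolding limitin_def topspace_form_topology
    by (simp add: dom_zero form_topology_def openin_topology_generated_by_iff)
qed

lemma limitin_form_topologyD: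
  assumes lim: "limitin (form_topology m E) u f F" and u: "\<And>i. u i \<in> D"
  shows "f \<in> D" "((\<lambda>i. Q (\<lambda>x. u i x - f x)) \<longlongrightarrow> 0) F" "limitin (tau m) u f F"
proof -
  show f: "f \<in> D"
    using limitin_topspace[OF lim] by (simp add: topspace_form_topology)
  show "((\<lambda>i. Q (\<lambda>x. u i x - f x)) \<longlongrightarrow> 0) F"
  proof (rule order_tendstoI)
    fix e :: real assume e: "0 < e"
    have "(\<lambda>x. f x) \<in> {g \<in> D. sqrt (Q (\<lambda>x. g x - f x)) < sqrt e}"
      using f e Q_scale[OF f, of 0] by simp
    then have "eventually (\<lambda>i. u i \<in> {g \<in> D. sqrt (Q (\<lambda>x. g x - f x)) < sqrt e}) F"
      using e by (intro limitinD[OF lim] openin_seminorm_ball f) simp_all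
    then show "eventually (\<lambda>i. Q (\<lambda>x. u i x - f x) < e) F"
      by (rule eventually_mono) simp
  next
    fix e :: real assume e: "e < 0"
    show "eventually (\<lambda>i. e < Q (\<lambda>x. u i x - f x)) F"
      by (intro always_eventually allI less_le_trans[OF e] enn2real_nonneg)
  qed
  show "limitin (tau m) u f F"
    unfolding limitin_def
  proof (intro conjI allI impI)
    show "f \<in> topspace (tau m)"
      using f dom_L0 by simp
    fix W assume "openin (tau m) W \<and> f \<in> W"
    then have "eventually (\<lambda>i. u i \<in> W \<inter> D) F"
      using f by (intro limitinD[OF lim] openin_form_tau) simp_all
    then show "eventually (\<lambda>i. u i \<in> W) F"
      by (rule eventually_mono) simp
  qed
qed

end

section \<open>Lower semicontinuity of closed forms\<close>

lemma loc_dist_commute: "loc_dist m U f g = loc_dist m U g f"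
  by (simp add: loc_dist_def abs_minus_commute)

text \<open>Dominated convergence with majorant \<open>indicator U\<close>, integrable because
  \<open>U\<close> has finite measure.\<close>

lemma loc_dist_tendsto_zero:
  assumes f: "\<And>n. f n \<in> L0 m" and g: "g \<in> L0 m"
    and lim: "AE x in m. (\<lambda>n. f n x) \<longlonglongrightarrow> g x"
    and U: "U \<in> sets m" "emeasure m U < \<infinity>"
  shows "(\<lambda>n. loc_dist m U (f n) g) \<longlonglongrightarrow> 0"
proof -
  note [measurable] = f[unfolded L0_def] g[unfolded L0_def] U(1)
  have "(\<lambda>n. \<integral>\<^sup>+x. ennreal (min \<bar>f n x - g x\<bar> 1) * indicator U x \<partial>m) \<longlonglongrightarrow> (\<integral>\<^sup>+x. 0 \<partial>m)"
  proof (rule nn_integral_dominated_convergence[where w = "indicator U"])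
    show "AE x in m. ennreal (min \<bar>f n x - g x\<bar> 1) * indicator U x \<le> indicator U x" for n
      by (auto simp: indicator_def)
    show "AE x in m. (\<lambda>n. ennreal (min \<bar>f n x - g x\<bar> 1) * indicator U x) \<longlonglongrightarrow> 0"
      using lim
    proof eventually_elim
      case (elim x)
      then have "(\<lambda>n. min \<bar>f n x - g x\<bar> 1) \<longlonglongrightarrow> min \<bar>g x - g x\<bar> 1"
        by (intro tendsto_intros)
      then have "(\<lambda>n. ennreal (min \<bar>f n x - g x\<bar> 1)) \<longlonglongrightarrow> ennreal 0"
        by (intro tendsto_ennrealI) simp
      then show ?case
        by (cases "x \<in> U") auto
    qed
  qed (use U in auto)
  then show ?thesis
    by (simp add: loc_dist_def)
qed

text \<open>Local distances see only sets of finite measure; \<open>semifinite\<close> ensures that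
  \<open>tau m\<close> nevertheless separates functions that differ on a non-null set.\<close>

locale closed_form_L0 = quadratic_form_L0 +
  assumes closed: "closed_form m E"
    and semifinite: "\<And>N. N \<in> sets m \<Longrightarrow>
      (\<And>U. U \<in> sets m \<Longrightarrow> U \<subseteq> N \<Longrightarrow> emeasure m U < \<infinity> \<Longrightarrow> emeasure m U = 0) \<Longrightarrow> emeasure m N = 0"
begin

lemma AE_eqI_loc_dist:
  assumes f: "f \<in> L0 m" and g: "g \<in> L0 m"
    and zero: "\<And>U. U \<in> sets m \<Longrightarrow> emeasure m U < \<infinity> \<Longrightarrow> loc_dist m U f g = 0"
  shows "AE x in m. f x = g x"
proof -
  note [measurable] = f[unfolded L0_def] g[unfolded L0_def]
  define N where "N = {x \<in> space m. f x \<noteq> g x}"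
  have N: "N \<in> sets m"
    unfolding N_def by measurable
  have "emeasure m N = 0"
  proof (rule semifinite[OF N])
    fix U assume U: "U \<in> sets m" "U \<subseteq> N" "emeasure m U < \<infinity>"
    note [measurable] = U(1)
    have "(\<integral>\<^sup>+x. ennreal (min \<bar>f x - g x\<bar> 1) * indicator U x \<partial>m) = 0"
      using zero[OF U(1,3)] by (simp add: loc_dist_def)
    then have "AE x in m. ennreal (min \<bar>f x - g x\<bar> 1) * indicator U x = 0"
      by (subst (asm) nn_integral_0_iff_AE) auto
    then have "AE x in m. x \<notin> U"
    proof eventually_elim
      case (elim x)
      then show ?case
        using U(2) by (auto simp: N_def indicator_def ennreal_eq_0_iff split: if_splits)
    qed
    then show "emeasure m U = 0"
      using AE_iff_null_sets[OF U(1)] by blast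
  qed
  then show ?thesis
    using N by (intro AE_I[of _ _ N]) (auto simp: N_def)
qed

text \<open>
  Minimising \<open>E\<close> over the convex sets \<open>S n\<close> makes the minimising sequence \<open>E\<close>-Cauchy by the
  parallelogram law. That every member of \<open>S n\<close> is pointwise no further from \<open>g\<close> than some
  \<open>f k\<close>, \<open>k \<ge> n\<close>, keeps the minimising sequence convergent to \<open>g\<close>.
\<close>
lemma lower_semicontinuous:
  assumes f: "\<And>n. f n \<in> L0 m" and g: "g \<in> L0 m"
    and lim: "AE x in m. (\<lambda>n. f n x) \<longlonglongrightarrow> g x"
    and le: "\<And>n. E (f n) \<le> c"
  shows "E g \<le> c"
proof (cases c)
  case (real C)
  define S where "S n = {u \<in> L0 m. E u \<le> c \<and> (AE x in m. \<exists>k\<ge>n. \<bar>u x - g x\<bar> \<le> \<bar>f k x - g x\<bar>)}" for n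
  define b where "b n = Inf ((\<lambda>u. Q u) ` S n)" for n
  have SD: "u \<in> D" if "u \<in> S n" for u n
    using that domI[of u C] real by (simp add: S_def)
  have SQ: "Q u \<le> C" if "u \<in> S n" for u n
    using that enn2real_mono[of "E u" "ennreal C"] real by (simp add: S_def)
  have S_mono: "S n \<subseteq> S k" if "k \<le> n" for n k
  proof
    fix u assume "u \<in> S n"
    moreover from this have "AE x in m. \<exists>l\<ge>k. \<bar>u x - g x\<bar> \<le> \<bar>f l x - g x\<bar>"
      unfolding S_def using that by (auto elim!: eventually_mono dest: le_trans[OF that])
    ultimately show "u \<in> S k"
      by (simp add: S_def)
  qed
  have fS: "f n \<in> S n" for n
    using f le by (auto simp: S_def)
  have bdd: "bdd_below ((\<lambda>u. Q u) ` S n)" for n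
    by (rule bdd_belowI2[of _ 0]) simp
  have b_le: "b n \<le> Q u" if "u \<in> S n" for n u
    unfolding b_def using that bdd by (intro cInf_lower) auto
  have "b k \<le> b n" if "k \<le> n" for k n
    unfolding b_def using S_mono[OF that] fS bdd by (intro cInf_superset_mono) auto
  \<comment> \<open>Smaller sets have larger infima, all at most \<open>C\<close>; convergence of
    \<open>b\<close> makes the bound in \<open>cauchy_le\<close> vanish.\<close>
  then have "incseq b"
    by (simp add: incseq_def)
  moreover have "b n \<le> C" for n
    using b_le[OF fS] SQ[OF fS] by (rule order_trans)
  ultimately obtain L where L: "b \<longlonglongrightarrow> L"
    using incseq_convergent[of b C] by blast
  \<comment> \<open>Infima need not be attained, so the near-minimisers carry a slack
    \<open>r n\<close> tending to 0.\<close>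
  define r where "r n = inverse (real (Suc n))" for n
  have r: "r \<longlonglongrightarrow> 0"
    unfolding r_def by (rule LIMSEQ_inverse_real_of_nat)
  have "\<exists>u\<in>S n. Q u < b n + r n" for n
    using cInf_lessD[of "(\<lambda>u. Q u) ` S n" "b n + r n"] fS[of n]
    by (auto simp: b_def r_def)
  then obtain u where u: "\<And>n. u n \<in> S n" "\<And>n. Q (u n) < b n + r n"
    by metis
  have uD: "u n \<in> D" and uL: "u n \<in> L0 m" for n
    using SD u dom_L0 by blast+
  \<comment> \<open>The parallelogram law bounds the energy. The index \<open>k\<close> in
    \<open>S\<close> may vary with the point, so at each point one of the two indices serves for the
    midpoint.\<close>
  have mid: "(\<lambda>x. (1 / 2) * (u i x + u j x)) \<in> S i" if "i \<le> j" for i j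
  proof -
    have ui: "u i \<in> S i" and uj: "u j \<in> S i"
      using u(1) S_mono[OF that] by auto
    have D: "(\<lambda>x. (1 / 2) * (u i x + u j x)) \<in> D"
      by (intro dom_scale dom_add uD)
    have "Q (\<lambda>x. (1 / 2) * (u i x + u j x)) = (1 / 2)\<^sup>2 * Q (\<lambda>x. u i x + u j x)"
      by (intro Q_scale dom_add uD)
    moreover have "Q (\<lambda>x. u i x + u j x) \<le> 2 * Q (u i) + 2 * Q (u j)"
      unfolding Q_parallelogram[OF uD uD] by simp
    ultimately have "Q (\<lambda>x. (1 / 2) * (u i x + u j x)) \<le> C"
      using SQ[OF ui] SQ[OF uj] by (simp add: power2_eq_square)
    then have "E (\<lambda>x. (1 / 2) * (u i x + u j x)) \<le> c"
      using E_le_iff[OF D] real by simp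
    moreover have "AE x in m. \<exists>k\<ge>i. \<bar>(1 / 2) * (u i x + u j x) - g x\<bar> \<le> \<bar>f k x - g x\<bar>"
    proof -
      have "AE x in m. \<exists>k\<ge>i. \<bar>u i x - g x\<bar> \<le> \<bar>f k x - g x\<bar>"
        "AE x in m. \<exists>k\<ge>i. \<bar>u j x - g x\<bar> \<le> \<bar>f k x - g x\<bar>"
        using ui uj by (auto simp: S_def)
      then show ?thesis
      proof eventually_elim
        case (elim x)
        then obtain k l where kl: "k \<ge> i" "l \<ge> i" "\<bar>u i x - g x\<bar> \<le> \<bar>f k x - g x\<bar>"
          "\<bar>u j x - g x\<bar> \<le> \<bar>f l x - g x\<bar>" by blast
        have "\<bar>(1 / 2) * (u i x + u j x) - g x\<bar> \<le> max \<bar>u i x - g x\<bar> \<bar>u j x - g x\<bar>"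
          by (simp add: max_def abs_if field_simps)
        also have "\<dots> \<le> max \<bar>f k x - g x\<bar> \<bar>f l x - g x\<bar>"
          using kl by (intro max.mono)
        finally show ?case
          using kl(1,2) by (auto simp: le_max_iff_disj)
      qed
    qed
    ultimately show ?thesis
      using D dom_L0 by (simp add: S_def)
  qed
  \<comment> \<open>The midpoint has energy at least \<open>b i\<close>, the endpoints at most
    \<open>b i + r i\<close> and \<open>b j + r j\<close>.\<close>
  have cauchy_le: "Q (\<lambda>x. u i x - u j x) \<le> 2 * \<bar>b i - b j\<bar> + 2 * r i + 2 * r j"
    if "i \<le> j" for i j
  proof -
    have "b i \<le> Q (\<lambda>x. (1 / 2) * (u i x + u j x))"
      by (intro b_le mid that)
    also have "\<dots> = (1 / 2)\<^sup>2 * Q (\<lambda>x. u i x + u j x)"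
      by (intro Q_scale dom_add uD)
    finally have "4 * b i \<le> Q (\<lambda>x. u i x + u j x)"
      by (simp add: power2_eq_square)
    then have "Q (\<lambda>x. u i x - u j x) \<le> 2 * Q (u i) + 2 * Q (u j) - 4 * b i"
      using Q_parallelogram[OF uD[of i] uD[of j]] by linarith
    also have "\<dots> \<le> 2 * b j - 2 * b i + 2 * r i + 2 * r j"
      using u(2)[of i] u(2)[of j] by linarith
    also have "\<dots> \<le> 2 * \<bar>b i - b j\<bar> + 2 * r i + 2 * r j"
      by (simp add: abs_if)
    finally show ?thesis .
  qed
  have cauchy_le': "Q (\<lambda>x. u i x - u j x) \<le> 2 * \<bar>b i - b j\<bar> + 2 * r i + 2 * r j"
    for i j
  proof (cases "i \<le> j")
    case False
    then show ?thesis
      using cauchy_le[of j i] Q_minus_commute[OF uD[of i] uD[of j]] by (simp add: abs_minus_commute[of "b i"])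
  qed (rule cauchy_le)
  have u_lim: "AE x in m. (\<lambda>n. u n x) \<longlonglongrightarrow> g x"
  proof -
    have "AE x in m. \<forall>n. \<exists>k\<ge>n. \<bar>u n x - g x\<bar> \<le> \<bar>f k x - g x\<bar>"
      using u(1) by (subst AE_all_countable) (simp add: S_def)
    with lim show ?thesis
    proof eventually_elim
      case (elim x)
      show ?case
      proof (rule LIMSEQ_I)
        fix r :: real assume "0 < r"
        then obtain N where N: "\<And>n. n \<ge> N \<Longrightarrow> norm (f n x - g x) < r"
          using LIMSEQ_D[OF elim(1)] by blast
        have "norm (u n x - g x) < r" if "n \<ge> N" for n
        proof -
          obtain k where "k \<ge> n" "\<bar>u n x - g x\<bar> \<le> \<bar>f k x - g x\<bar>"
            using elim(2) by blast
          then show ?thesis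
            using N[of k] that by simp
        qed
        then show "\<exists>N. \<forall>n\<ge>N. norm (u n x - g x) < r"
          by blast
      qed
    qed
  qed
  \<comment> \<open>Convergence of the differences to 0 along the product filter is the Cauchy
    property of the image filter \<open>?F\<close>.\<close>
  let ?P = "sequentially \<times>\<^sub>F sequentially"
  let ?v = "\<lambda>p x. u (fst p) x - u (snd p) x"
  have vD: "?v p \<in> D" for p
    by (intro dom_diff uD)
  have "limitin (form_topology m E) ?v (\<lambda>x. 0) ?P"
  proof (rule limitin_form_topology_zero[OF vD])
    have "((\<lambda>p. 2 * \<bar>b (fst p) - b (snd p)\<bar> + 2 * r (fst p) + 2 * r (snd p))
        \<longlongrightarrow> 2 * \<bar>L - L\<bar> + 2 * 0 + 2 * 0) ?P"
      by (intro tendsto_intros filterlim_compose[OF L] filterlim_compose[OF r]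
        filterlim_fst filterlim_snd)
    then have "((\<lambda>p. 2 * \<bar>b (fst p) - b (snd p)\<bar> + 2 * r (fst p) + 2 * r (snd p))
        \<longlongrightarrow> 0) ?P" by simp
    then show "((\<lambda>p. Q (?v p)) \<longlongrightarrow> 0) ?P"
      by (rule tendsto_sandwich[OF _ _ tendsto_const, rotated 2])
        (auto intro!: always_eventually cauchy_le')
    have "((\<lambda>p. loc_dist m U (?v p) (\<lambda>x. 0)) \<longlongrightarrow> 0) ?P"
      if U: "U \<in> sets m" "emeasure m U < \<infinity>" for U
    proof (rule tendsto_sandwich[OF _ _ tendsto_const])
      have "((\<lambda>p. loc_dist m U (u (fst p)) g + loc_dist m U (u (snd p)) g) \<longlongrightarrow> 0 + 0) ?P"
        by (intro tendsto_add filterlim_compose[OF loc_dist_tendsto_zero[OF uL g u_lim U]]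
          filterlim_fst filterlim_snd)
      then show "((\<lambda>p. loc_dist m U (u (fst p)) g + loc_dist m U (u (snd p)) g) \<longlongrightarrow> 0) ?P"
        by simp
      show "eventually (\<lambda>p. loc_dist m U (?v p) (\<lambda>x. 0)
          \<le> loc_dist m U (u (fst p)) g + loc_dist m U (u (snd p)) g) ?P"
        using loc_dist_triangle[OF uL g uL U(1)]
        by (intro always_eventually allI) (simp add: loc_dist_def abs_minus_commute)
    qed simp
    then show "limitin (tau m) ?v (\<lambda>x. 0) ?P"
      using vD dom_L0 by (subst limitin_tau_iff) (auto simp: loc_dist_def L0_def)
  qed
  then have ev: "eventually (\<lambda>p. ?v p \<in> N) ?P"
    if "openin (form_topology m E) N" "(\<lambda>x. 0) \<in> N" for N
    using that by (simp add: limitin_def)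
  let ?F = "filtermap u sequentially"
  have "form_cauchy m E ?F"
    unfolding form_cauchy_def
  proof (intro allI impI)
    fix N assume "openin (form_topology m E) N \<and> (\<lambda>x. 0) \<in> N"
    with ev[of N] obtain k where k: "\<And>i j. i \<ge> k \<Longrightarrow> j \<ge> k \<Longrightarrow> (\<lambda>x. u i x - u j x) \<in> N"
      by (auto simp: eventually_prod_sequentially)
    show "\<forall>\<^sub>F (f, g) in ?F \<times>\<^sub>F ?F. (\<lambda>x. f x - g x) \<in> N"
      unfolding eventually_prod_filter eventually_filtermap
      by (rule exI[of _ "\<lambda>f. f \<in> u ` {k..}"], rule exI[of _ "\<lambda>f. f \<in> u ` {k..}"])
        (auto simp: eventually_sequentially k)
  qed
  moreover have "?F \<noteq> bot" "?F \<le> principal D"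
    using uD by (simp_all add: filtermap_bot_iff le_principal eventually_filtermap)
  ultimately obtain g' where "limitin (form_topology m E) (\<lambda>g. g) g' ?F"
    using closed unfolding closed_form_def by blast
  then have lim': "limitin (form_topology m E) u g' sequentially"
    by (simp add: limitin_def eventually_filtermap)
  note g' = limitin_form_topologyD[OF lim' uD]
  \<comment> \<open>The form limit \<open>g'\<close> and the almost everywhere limit
    \<open>g\<close> are both limits of \<open>u\<close> in \<open>tau m\<close>.\<close>
  have "AE x in m. g x = g' x"
  proof (rule AE_eqI_loc_dist[OF g dom_L0[OF g'(1)]])
    fix U assume U: "U \<in> sets m" "emeasure m U < \<infinity>"
    have "(\<lambda>n. loc_dist m U (u n) g + loc_dist m U (u n) g') \<longlonglongrightarrow> 0 + 0"
    proof (rule tendsto_add)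
      show "(\<lambda>n. loc_dist m U (u n) g') \<longlonglongrightarrow> 0"
        using g'(3) U unfolding limitin_tau_iff[of u, OF uL] by (simp add: loc_dist_def)
    qed (rule loc_dist_tendsto_zero[OF uL g u_lim U])
    moreover have "loc_dist m U g g' \<le> loc_dist m U (u n) g + loc_dist m U (u n) g'" for n
      using loc_dist_triangle[OF g uL dom_L0[OF g'(1)] U(1)] by (simp add: loc_dist_commute)
    ultimately have "loc_dist m U g g' \<le> 0"
      by (intro LIMSEQ_le_const[of _ 0]) auto
    then show "loc_dist m U g g' = 0" by simp
  qed
  then have "E g = E g'"
    by (rule cong_AE[OF g dom_L0[OF g'(1)]])
  moreover have "Q g' \<le> C"
  proof (rule ccontr)
    have d: "(\<lambda>x. - (u n x - g' x)) \<in> D" for n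
      using dom_scale[OF dom_diff[OF uD g'(1)], of "-1" n] by simp
    assume "\<not> Q g' \<le> C"
    have null: "(\<lambda>n. Q (\<lambda>x. - (u n x - g' x))) \<longlonglongrightarrow> 0"
      unfolding Q_minus[OF dom_diff[OF uD g'(1)]] by (rule g'(2))
    \<comment> \<open>In \<open>g' = u n + (g' - u n)\<close> the parameter \<open>k\<close> of
      \<open>Q_add_le\<close> is fixed first; then \<open>n\<close> tends to infinity.\<close>
    obtain k where k: "0 < k" "(1 + 1 / real k) * C < Q g'"
    proof -
      have "(\<lambda>n. (1 + 1 / real (Suc n)) * C) \<longlonglongrightarrow> (1 + 0) * C"
        by (intro tendsto_intros LIMSEQ_Suc lim_1_over_n)
      then have "eventually (\<lambda>n. (1 + 1 / real (Suc n)) * C < Q g') sequentially"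
        using \<open>\<not> Q g' \<le> C\<close> by (intro order_tendstoD(2)) auto
      then show ?thesis
        using that[of "Suc _"] by (auto simp: eventually_sequentially)
    qed
    have "(\<lambda>n. (1 + 1 / real k) * C + (1 + real k ^ 3) * Q (\<lambda>x. - (u n x - g' x)))
        \<longlonglongrightarrow> (1 + 1 / real k) * C + (1 + real k ^ 3) * 0"
      by (intro tendsto_intros null)
    moreover have "Q g' \<le> (1 + 1 / real k) * C + (1 + real k ^ 3) * Q (\<lambda>x. - (u n x - g' x))" for n
    proof -
      have "Q g' \<le> (1 + 1 / real k) * Q (u n) + (1 + real k ^ 3) * Q (\<lambda>x. - (u n x - g' x))"
        using Q_add_le[OF uD d k(1), of n n] by simp
      also have "(1 + 1 / real k) * Q (u n) \<le> (1 + 1 / real k) * C"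
        using SQ[OF u(1)] by (intro mult_left_mono) auto
      finally show ?thesis by simp
    qed
    ultimately have "Q g' \<le> (1 + 1 / real k) * C + (1 + real k ^ 3) * 0"
      by (intro LIMSEQ_le_const) auto
    then show False
      using k by simp
  qed
  ultimately show ?thesis
    using E_le_iff[OF g'(1)] real by simp
qed simp

end

section \<open>Markovian contractions and superharmonic truncation\<close>

text \<open>Monotonicity and the range squeeze \<open>C\<close> into \<open>[-e, 0]\<close> left of
  0 and into \<open>[1, 1 + e]\<close> right of 1. Hence cutoffs converge uniformly to the unit
  contraction as \<open>e\<close> tends to 0.\<close>

lemma cutoff_dist_unit_interval:
  assumes "cutoff e C" "0 < e"
  shows "\<bar>C y - max 0 (min 1 y)\<bar> \<le> e"
proof -
  have C: "mono C" "C y \<in> {- e..1 + e}" "\<forall>x\<in>{0..1}. C x = x"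
    using assms(1) unfolding cutoff_def by blast+
  consider "y < 0" | "0 \<le> y" "y \<le> 1" | "1 < y" by linarith
  then show ?thesis
  proof cases
    case 1
    then have "C y \<le> C 0" using C(1) by (auto simp: mono_def)
    then show ?thesis using C 1 by simp
  next
    case 2
    then show ?thesis using C assms(2) by simp
  next
    case 3
    then have "C 1 \<le> C y" using C(1) by (auto simp: mono_def)
    then show ?thesis using C 3 by simp
  qed
qed

text \<open>As \<open>j\<close> tends to infinity this becomes the tail infimum from
  \<open>N\<close> on, whose limit in \<open>N\<close> is the lower limit of the sequence.\<close>

primrec running_min :: "(nat \<Rightarrow> 'a \<Rightarrow> real) \<Rightarrow> nat \<Rightarrow> nat \<Rightarrow> 'a \<Rightarrow> real" where
  "running_min f N 0 = f N"
| "running_min f N (Suc j) = (\<lambda>x. min (running_min f N j x) (f (N + Suc j) x))"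

lemma running_min_ge: "(\<And>k. k \<le> N + j \<Longrightarrow> c \<le> f k x) \<Longrightarrow> c \<le> running_min f N j x"
  by (induction j) auto

lemma running_min_Suc_le: "running_min f N (Suc j) x \<le> running_min f (Suc N) j x"
  by (induction j) (auto simp: min_le_iff_disj)

locale energy_form_L0 = closed_form_L0 +
  assumes markovian: "markovian m E"
begin

text \<open>The Markov property provides approximate cutoffs; they converge to the unit contraction,
  and lower semicontinuity carries the energy bound to the limit.\<close>

lemma E_unit_contraction:
  assumes f: "f \<in> L0 m"
  shows "E (\<lambda>x. max 0 (min 1 (f x))) \<le> E f"
proof -
  define e where "e n = inverse (real (Suc n))" for n
  have e: "0 < e n" for n
    by (simp add: e_def)
  have "\<exists>C. cutoff (e n) C \<and> E (C \<circ> f) \<le> E f" for n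
    using markovian e[of n] f unfolding markovian_def by blast
  then obtain C where C: "\<And>n. cutoff (e n) (C n)" "\<And>n. E (C n \<circ> f) \<le> E f"
    by metis
  show ?thesis
  proof (rule lower_semicontinuous[where f = "\<lambda>n. C n \<circ> f"])
    show "C n \<circ> f \<in> L0 m" for n
      using C(1)[of n] f unfolding L0_def cutoff_def
      by (auto intro: measurable_comp borel_measurable_mono)
    show "AE x in m. (\<lambda>n. (C n \<circ> f) x) \<longlonglongrightarrow> max 0 (min 1 (f x))"
    proof (rule AE_I2)
      fix x
      have "(\<lambda>n. C n (f x) - max 0 (min 1 (f x))) \<longlonglongrightarrow> 0"
        by (rule Lim_null_comparison[OF _ LIMSEQ_inverse_real_of_nat])
          (use cutoff_dist_unit_interval[OF C(1) e] in \<open>simp add: e_def\<close>)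
      then show "(\<lambda>n. (C n \<circ> f) x) \<longlonglongrightarrow> max 0 (min 1 (f x))"
        by (simp add: LIM_zero_iff)
    qed
  qed (use f C(2) in \<open>auto simp: L0_def\<close>)
qed

text \<open>Rescaling by \<open>1 / c\<close> reduces to the unit interval, and the two factors from
  homogeneity cancel.\<close>

lemma E_interval_contraction:
  assumes f: "f \<in> L0 m" and c: "0 < c"
  shows "E (\<lambda>x. max 0 (min c (f x))) \<le> E f"
proof -
  have g: "(\<lambda>x. (1 / c) * f x) \<in> L0 m"
    using f by (simp add: L0_def)
  then have g': "(\<lambda>x. max 0 (min 1 ((1 / c) * f x))) \<in> L0 m"
    by (simp add: L0_def)
  have "(\<lambda>x. max 0 (min c (f x))) = (\<lambda>x. c * max 0 (min 1 ((1 / c) * f x)))"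
    using c by (auto simp: fun_eq_iff max_def min_def field_simps)
  then have "E (\<lambda>x. max 0 (min c (f x))) = ennreal (c\<^sup>2) * E (\<lambda>x. max 0 (min 1 ((1 / c) * f x)))"
    using scale[OF g', of c] by simp
  also have "\<dots> \<le> ennreal (c\<^sup>2) * E (\<lambda>x. (1 / c) * f x)"
    by (intro mult_left_mono E_unit_contraction g) simp
  also have "\<dots> = ennreal (c\<^sup>2) * ennreal ((1 / c)\<^sup>2) * E f"
    unfolding scale[OF f] by (simp add: mult.assoc)
  also have "ennreal (c\<^sup>2) * ennreal ((1 / c)\<^sup>2) = 1"
    using c by (subst ennreal_mult[symmetric]) (simp_all add: power_divide)
  finally show ?thesis by simp
qed

text \<open>At each point the truncations at heights \<open>Suc n\<close>, positive already for
  \<open>n = 0\<close>, eventually equal the positive part.\<close>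

lemma E_pos_part:
  assumes f: "f \<in> L0 m"
  shows "E (\<lambda>x. max 0 (f x)) \<le> E f"
proof (rule lower_semicontinuous[where f = "\<lambda>n x. max 0 (min (real (Suc n)) (f x))"])
  show "AE x in m. (\<lambda>n. max 0 (min (real (Suc n)) (f x))) \<longlonglongrightarrow> max 0 (f x)"
  proof (rule AE_I2)
    fix x
    obtain N where "f x \<le> real N"
      using real_arch_simple by blast
    then have "eventually (\<lambda>n. max 0 (min (real (Suc n)) (f x)) = max 0 (f x)) sequentially"
      by (intro eventually_sequentiallyI[of N]) (auto simp: min_def max_def)
    then show "(\<lambda>n. max 0 (min (real (Suc n)) (f x))) \<longlonglongrightarrow> max 0 (f x)"
      by (rule tendsto_eventually)
  qed
qed (use f E_interval_contraction[OF f] in \<open>auto simp: L0_def simp del: of_nat_Suc\<close>)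

section \<open>Lattice operations on the domain\<close>

lemma dom_le: "u \<in> D \<Longrightarrow> v \<in> L0 m \<Longrightarrow> E v \<le> E u \<Longrightarrow> v \<in> D"
  by (auto simp: form_dom_def)

lemma Q_le: "u \<in> D \<Longrightarrow> E v \<le> E u \<Longrightarrow> Q v \<le> Q u"
  by (rule enn2real_mono) (auto simp: form_dom_def)

lemma dom_pos_part: "u \<in> D \<Longrightarrow> (\<lambda>x. max 0 (u x)) \<in> D"
  using E_pos_part[OF dom_L0[of u]] by (auto simp: form_dom_def L0_def)

lemma dom_neg_part: "u \<in> D \<Longrightarrow> (\<lambda>x. max 0 (- u x)) \<in> D"
  using dom_pos_part[OF dom_scale[of u "-1"]] by simp

text \<open>The positive part of \<open>u\<^sup>+ - u\<^sup>- / n\<close> is \<open>u\<^sup>+\<close>; let \<open>n\<close> tend to infinity.\<close>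
lemma B_pos_neg:
  assumes u: "u \<in> D"
  shows "B (\<lambda>x. max 0 (u x)) (\<lambda>x. max 0 (- u x)) \<le> 0"
proof -
  let ?a = "\<lambda>x. max 0 (u x)" and ?b = "\<lambda>x. max 0 (- u x)"
  have a: "?a \<in> D" and b: "?b \<in> D"
    using dom_pos_part[OF u] dom_neg_part[OF u] .
  have "B ?a ?b \<le> (1 / real (Suc n)) * (Q ?b / 2)" for n
  proof -
    let ?c = "\<lambda>x. (1 / real (Suc n)) * ?b x"
    have c: "?c \<in> D"
      by (rule dom_scale[OF b])
    have eq: "(\<lambda>x. max 0 (?a x - ?c x)) = ?a"
    proof
      fix x
      have "0 \<le> ?c x" "0 < u x \<Longrightarrow> ?c x = 0"
        by simp_all
      then show "max 0 (?a x - ?c x) = ?a x"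
        by (cases "0 < u x") auto
    qed
    have "Q (\<lambda>x. max 0 (?a x - ?c x)) \<le> Q (\<lambda>x. ?a x - ?c x)"
      using dom_diff[OF a c] by (intro Q_le E_pos_part dom_L0)
    then have "Q ?a \<le> Q (\<lambda>x. ?a x - ?c x)"
      unfolding eq .
    then have "2 * B ?a ?c \<le> Q ?c"
      unfolding Q_diff[OF a c] by linarith
    also have "Q ?c = (1 / real (Suc n))\<^sup>2 * Q ?b"
      by (rule Q_scale[OF b])
    finally have "real (Suc n) * B ?a ?c \<le> real (Suc n) * ((1 / real (Suc n))\<^sup>2 * Q ?b / 2)"
      by (intro mult_left_mono) simp_all
    also have "\<dots> = (1 / real (Suc n)) * (Q ?b / 2)"
      by (simp add: power2_eq_square field_simps del: of_nat_Suc)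
    also have "real (Suc n) * B ?a ?c = B ?a ?b"
      using B_divide_of_nat[OF b a, of "Suc n"] B_commute[OF a b] B_commute[OF a c] by simp
    finally show ?thesis .
  qed
  moreover have "(\<lambda>n. (1 / real (Suc n)) * (Q ?b / 2)) \<longlonglongrightarrow> 0 * (Q ?b / 2)"
    by (intro tendsto_intros LIMSEQ_Suc lim_1_over_n)
  ultimately show ?thesis
    by (intro LIMSEQ_le_const[of _ 0]) auto
qed

text \<open>For the positive part \<open>a\<close> and the negative part \<open>b\<close>,
  \<open>Q (a + b) - Q (a - b) = 4 * B a b\<close>, which is nonpositive by
  \<open>B_pos_neg\<close>.\<close>

lemma Q_abs:
  assumes u: "u \<in> D"
  shows "(\<lambda>x. \<bar>u x\<bar>) \<in> D" "Q (\<lambda>x. \<bar>u x\<bar>) \<le> Q u"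
proof -
  let ?a = "\<lambda>x. max 0 (u x)" and ?b = "\<lambda>x. max 0 (- u x)"
  have a: "?a \<in> D" and b: "?b \<in> D"
    using dom_pos_part[OF u] dom_neg_part[OF u] .
  have abs: "(\<lambda>x. \<bar>u x\<bar>) = (\<lambda>x. ?a x + ?b x)" and u_eq: "u = (\<lambda>x. ?a x - ?b x)"
    by (auto simp: fun_eq_iff)
  show "(\<lambda>x. \<bar>u x\<bar>) \<in> D"
    unfolding abs by (rule dom_add[OF a b])
  show "Q (\<lambda>x. \<bar>u x\<bar>) \<le> Q u"
    \<comment> \<open>The first four occurrences of \<open>u\<close> sit inside \<open>?a\<close>
      and \<open>?b\<close>; only the one on the right-hand side is split.\<close>
    unfolding abs Q_add[OF a b] by (subst (5) u_eq) (use Q_diff[OF a b] B_pos_neg[OF u] in simp)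
qed

text \<open>The minimum is half of \<open>(u + v) - \<bar>u - v\<bar>\<close>. The parallelogram law
  bounds its energy by half of \<open>Q (u + v) + Q \<bar>u - v\<bar>\<close>; after
  \<open>Q_abs\<close>, a second use of the law gives the claim.\<close>

lemma Q_min:
  assumes u: "u \<in> D" and v: "v \<in> D"
  shows "(\<lambda>x. min (u x) (v x)) \<in> D" "Q (\<lambda>x. min (u x) (v x)) \<le> Q u + Q v"
proof -
  have eq: "(\<lambda>x. min (u x) (v x)) = (\<lambda>x. (1 / 2) * ((u x + v x) - \<bar>u x - v x\<bar>))"
    by (auto simp: fun_eq_iff min_def)
  note a = Q_abs[OF dom_diff[OF u v]]
  note d = dom_diff[OF dom_add[OF u v] a(1)]
  show "(\<lambda>x. min (u x) (v x)) \<in> D"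
    unfolding eq by (rule dom_scale[OF d])
  have "Q (\<lambda>x. min (u x) (v x)) = (1 / 2)\<^sup>2 * Q (\<lambda>x. (u x + v x) - \<bar>u x - v x\<bar>)"
    unfolding eq by (rule Q_scale[OF d])
  moreover have "Q (\<lambda>x. (u x + v x) - \<bar>u x - v x\<bar>) \<le> 2 * Q (\<lambda>x. u x + v x) + 2 * Q (\<lambda>x. \<bar>u x - v x\<bar>)"
    unfolding Q_parallelogram[OF dom_add[OF u v] a(1)] by simp
  ultimately show "Q (\<lambda>x. min (u x) (v x)) \<le> Q u + Q v"
    using a(2) Q_parallelogram[OF u v] by (simp add: power2_eq_square)
qed

text \<open>With \<open>w = u - h\<close> one has \<open>u = min u h + w\<^sup>+\<close> and \<open>min u h = h - w\<^sup>-\<close>.\<close>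
lemma Q_min_superharmonic:
  assumes u: "u \<in> D" and h: "superharmonic m E h"
  shows "Q (\<lambda>x. min (u x) (h x)) \<le> Q u"
proof -
  have hD: "h \<in> D"
    using h by (simp add: superharmonic_def)
  let ?p = "\<lambda>x. max 0 (u x - h x)" and ?n = "\<lambda>x. max 0 (- (u x - h x))"
  let ?g = "\<lambda>x. min (u x) (h x)"
  have p: "?p \<in> D" and n: "?n \<in> D"
    using dom_pos_part[OF dom_diff[OF u hD]] dom_neg_part[OF dom_diff[OF u hD]] .
  have g: "?g \<in> D"
    by (rule Q_min[OF u hD])
  have u_eq: "u = (\<lambda>x. ?g x + ?p x)" and h_eq: "h = (\<lambda>x. ?g x + ?n x)"
    by (auto simp: fun_eq_iff)
  \<comment> \<open>\<open>B ?g ?p\<close> is nonnegative: \<open>B h ?p\<close> is so by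
    superharmonicity, and its other summand \<open>B ?n ?p\<close> is nonpositive.\<close>
  have "0 \<le> B h ?p"
    using h p by (simp add: superharmonic_def)
  also have "B h ?p = B ?g ?p + B ?n ?p"
    using B_add_left[OF g n p] h_eq by simp
  also have "B ?n ?p \<le> 0"
    using B_pos_neg[OF dom_diff[OF u hD]] B_commute[OF n p] by simp
  finally have "0 \<le> B ?g ?p" by simp
  moreover have "Q u = Q ?g + Q ?p + 2 * B ?g ?p"
    using Q_add[OF g p] u_eq by simp
  ultimately show ?thesis
    using enn2real_nonneg[of "E ?p"] by linarith
qed

text \<open>Dividing by \<open>c\<close> reduces truncation at \<open>c * h\<close> to truncation at
  \<open>h\<close>.\<close>

lemma Q_min_scale_superharmonic:
  assumes u: "u \<in> D" and h: "superharmonic m E h" and c: "0 < c"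
  shows "(\<lambda>x. min (u x) (c * h x)) \<in> D" "Q (\<lambda>x. min (u x) (c * h x)) \<le> Q u"
proof -
  have hD: "h \<in> D"
    using h by (simp add: superharmonic_def)
  show "(\<lambda>x. min (u x) (c * h x)) \<in> D"
    by (rule Q_min[OF u dom_scale[OF hD]])
  have u': "(\<lambda>x. (1 / c) * u x) \<in> D"
    by (rule dom_scale[OF u])
  have "(\<lambda>x. min (u x) (c * h x)) = (\<lambda>x. c * min ((1 / c) * u x) (h x))"
    using c by (auto simp: fun_eq_iff min_def field_simps)
  then have "Q (\<lambda>x. min (u x) (c * h x)) = c\<^sup>2 * Q (\<lambda>x. min ((1 / c) * u x) (h x))"
    using Q_scale[OF Q_min(1)[OF u' hD], of c] by simp
  also have "\<dots> \<le> c\<^sup>2 * Q (\<lambda>x. (1 / c) * u x)"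
    by (intro mult_left_mono Q_min_superharmonic u' h) simp
  also have "\<dots> = c\<^sup>2 * ((1 / c)\<^sup>2 * Q u)"
    by (simp only: Q_scale[OF u])
  also have "\<dots> = Q u"
    using c by (simp add: power_divide)
  finally show "Q (\<lambda>x. min (u x) (c * h x)) \<le> Q u" .
qed

section \<open>Running minima of functions with geometrically decaying energy\<close>

lemma running_min_dom:
  assumes f: "\<And>n. f n \<in> D" "\<And>n. Q (f n) \<le> (1 / 4) ^ n"
  shows "running_min f N j \<in> D" "Q (running_min f N j) \<le> 2 * (1 / 4) ^ N"
proof -
  \<comment> \<open>The subtracted term strengthens the induction: it absorbs the next energy
    \<open>(1 / 4) ^ (N + Suc j)\<close>.\<close>
  have "running_min f N j \<in> D \<and> Q (running_min f N j) \<le> 2 * (1 / 4) ^ N - (1 / 4) ^ (N + j)"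
  proof (induction j)
    case 0
    then show ?case using f[of N] by simp
  next
    case (Suc j)
    have "(0::real) \<le> (1 / 4) ^ (N + j)" "Q (f (N + Suc j)) \<le> (1 / 4) ^ (N + j) / 4"
      using f(2)[of "N + Suc j"] by simp_all
    moreover have "Q (running_min f N (Suc j)) \<le> Q (running_min f N j) + Q (f (N + Suc j))"
      unfolding running_min.simps using Suc f by (intro Q_min) auto
    moreover have "running_min f N (Suc j) \<in> D"
      unfolding running_min.simps using Suc f by (intro Q_min) auto
    moreover have "((1::real) / 4) ^ (N + Suc j) = (1 / 4) ^ (N + j) / 4"
      by simp
    ultimately show ?case
      using Suc by linarith
  qed
  moreover have "(0::real) \<le> (1 / 4) ^ (N + j)" by simp
  ultimately show "running_min f N j \<in> D" "Q (running_min f N j) \<le> 2 * (1 / 4) ^ N"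
    by linarith+
qed

text \<open>The increasing limit \<open>G\<close> of \<open>inf {f k | k \<ge> N}\<close> satisfies \<open>E G = 0\<close>.\<close>
lemma running_min_tendsto_zero:
  assumes f: "\<And>n. f n \<in> D" "\<And>n. Q (f n) \<le> (1 / 4) ^ n"
    and bounds: "\<And>n x. 0 \<le> f n x" "\<And>n x. f n x \<le> H x"
    and transient: "transient m E"
  shows "AE x in m. (\<lambda>j. running_min f 0 j x) \<longlonglongrightarrow> 0"
proof -
  let ?r = "running_min f"
  have r: "?r N j \<in> L0 m" "E (?r N j) \<le> ennreal (2 * (1 / 4) ^ N)" for N j
    using running_min_dom[OF f, of N j] dom_L0 by (auto simp: E_le_iff)
  have r_nonneg: "0 \<le> ?r N j x" for N j x
    using bounds(1) by (intro running_min_ge)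
  define g where "g N x = (INF j. ?r N j x)" for N x
  define G where "G x = (SUP N. g N x)" for x
  have r_lim: "(\<lambda>j. ?r N j x) \<longlonglongrightarrow> g N x" for N x
    unfolding g_def using r_nonneg
    by (intro LIMSEQ_decseq_INF bdd_belowI2[of _ 0]) (auto intro!: decseq_SucI)
  have g_le: "g N x \<le> ?r N j x" for N j x
    unfolding g_def using r_nonneg by (intro cINF_lower bdd_belowI2[of _ 0]) auto
  have g_nonneg: "0 \<le> g N x" for N x
    unfolding g_def using r_nonneg by (intro cINF_greatest) auto
  \<comment> \<open>The majorant \<open>H\<close> makes the real supremum defining \<open>G\<close>
    a genuine one at every point.\<close>
  have bdd: "bdd_above (range (\<lambda>N. g N x))" for x
    using g_le[of _ x 0] bounds(2) by (intro bdd_aboveI2[of _ _ "H x"]) (auto intro: order_trans)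
  have g_Suc: "g N x \<le> g (Suc N) x" for N x
    unfolding g_def[of "Suc N"]
  proof (rule cINF_greatest)
    fix j
    have "g N x \<le> ?r N (Suc j) x"
      by (rule g_le)
    also have "\<dots> \<le> ?r (Suc N) j x"
      by (rule running_min_Suc_le)
    finally show "g N x \<le> ?r (Suc N) j x" .
  qed simp
  have g_lim: "(\<lambda>N. g N x) \<longlonglongrightarrow> G x" for x
    unfolding G_def using g_Suc bdd by (intro LIMSEQ_incseq_SUP) (auto intro!: incseq_SucI)
  have g_L0: "g N \<in> L0 m" for N
    unfolding L0_def
    by (rule borel_measurable_LIMSEQ_real[OF r_lim]) (use r(1) in \<open>simp add: L0_def\<close>)
  have G_L0: "G \<in> L0 m"
    unfolding L0_def
    by (rule borel_measurable_LIMSEQ_real[OF g_lim]) (use g_L0 in \<open>simp add: L0_def\<close>)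
  have E_g: "E (g N) \<le> ennreal (2 * (1 / 4) ^ N)" for N
    by (rule lower_semicontinuous[where f = "?r N", OF r(1) g_L0 _ r(2)]) (simp add: r_lim)
  \<comment> \<open>Starting the approximation at index \<open>N\<close> exploits the small energy
    of the tails; letting \<open>N\<close> grow gives \<open>E G = 0\<close>.\<close>
  have "E G \<le> ennreal (2 * (1 / 4) ^ N)" for N
  proof (rule lower_semicontinuous[where f = "\<lambda>n. g (n + N)", OF g_L0 G_L0])
    show "AE x in m. (\<lambda>n. g (n + N) x) \<longlonglongrightarrow> G x"
      using LIMSEQ_ignore_initial_segment[OF g_lim] by simp
    show "E (g (n + N)) \<le> ennreal (2 * (1 / 4) ^ N)" for n
      by (rule order_trans[OF E_g])
        (intro ennreal_leI mult_left_mono power_decreasing, simp_all)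
  qed
  moreover have "(\<lambda>N. ennreal (2 * (1 / 4) ^ N)) \<longlonglongrightarrow> ennreal (2 * 0)"
    by (intro tendsto_ennrealI tendsto_intros LIMSEQ_power_zero) simp
  ultimately have "E G \<le> ennreal (2 * 0)"
    by (intro LIMSEQ_le_const) auto
  then have "G \<in> form_ker m E"
    using G_L0 by (simp add: form_ker_def)
  then have "AE x in m. G x = 0"
    using transient by (simp add: transient_def)
  then show ?thesis
  proof eventually_elim
    case (elim x)
    \<comment> \<open>The infimum \<open>g 0\<close> lies between 0 and \<open>G\<close>, and it is
      the limit of \<open>running_min f 0\<close>.\<close>
    have "g 0 x \<le> G x"
      unfolding G_def using bdd by (intro cSUP_upper) auto
    then have "g 0 x = 0"
      using g_nonneg[of 0 x] elim by simp
    then show ?case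
      using r_lim[of 0 x] by simp
  qed
qed

end

section \<open>Regular forms and Silverstein extensions\<close>

text \<open>Inner regularity expresses the measure of \<open>N\<close> through its compact subsets,
  which have finite measure.\<close>

lemma radon_measure_semifinite:
  assumes "radon_measure m" "N \<in> sets m"
    and zero: "\<And>U. U \<in> sets m \<Longrightarrow> U \<subseteq> N \<Longrightarrow> emeasure m U < \<infinity> \<Longrightarrow> emeasure m U = 0"
  shows "emeasure m N = 0"
proof -
  have "emeasure m N = (SUP K\<in>{K. compact K \<and> K \<in> sets borel \<and> K \<subseteq> N}. emeasure m K)"
    using assms(1,2) unfolding radon_measure_def by blast
  also have "\<dots> \<le> 0"
    using assms(1) zero unfolding radon_measure_def by (intro SUP_least) auto
  finally show ?thesis by simp
qed

lemma energy_form_L0_radon: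
  assumes "radon_measure m" "energy_form m E"
  shows "energy_form_L0 m E"
  using assms radon_measure_semifinite[OF assms(1)]
  by unfold_locales (auto simp: energy_form_def)

text \<open>Finitely many open sets contained in compact ones cover \<open>K\<close>, and a tent
  function of the distance to \<open>K\<close> is supported in the union of the compact sets. Height
  2 leaves room for a uniform error of 1.\<close>

lemma exists_Cc_ge_on_compact:
  fixes K :: "'a::metric_space set"
  assumes lc: "locally_compact_space (euclidean :: 'a topology)" and K: "compact K"
  shows "\<exists>f\<in>Cc. \<forall>x\<in>K. 2 \<le> f x"
\<comment> \<open>\<open>infdist\<close> to the empty set is 0 by convention, so the tent function
  would be constantly 2.\<close>
proof (cases "K = {}")
  case True
  then show ?thesis
    by (intro bexI[of _ "\<lambda>x. 0"]) (auto simp: Cc_def)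
next
  case False
  have "\<forall>x::'a. \<exists>U L. open U \<and> compact L \<and> x \<in> U \<and> U \<subseteq> L"
    using lc unfolding locally_compact_space_def by auto
  then have "\<exists>U. \<forall>x::'a. \<exists>L. open (U x) \<and> compact L \<and> x \<in> U x \<and> U x \<subseteq> L"
    by (intro choice)
  then obtain U where "\<forall>x::'a. \<exists>L. open (U x) \<and> compact L \<and> x \<in> U x \<and> U x \<subseteq> L" ..
  then have "\<exists>L. \<forall>x::'a. open (U x) \<and> compact (L x) \<and> x \<in> U x \<and> U x \<subseteq> L x"
    by (rule choice)
  then obtain L where U: "\<And>x::'a. open (U x)" "\<And>x. compact (L x)" "\<And>x. x \<in> U x"
    "\<And>x. U x \<subseteq> L x"
    by blast
  obtain T where T: "finite T" "K \<subseteq> (\<Union>x\<in>T. U x)"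
    by (rule compactE_image[OF K, of K U]) (use U in auto)
  define V where "V = (\<Union>x\<in>T. U x)"
  define M where "M = (\<Union>x\<in>T. L x)"
  have M: "compact M" "V \<subseteq> M"
    unfolding M_def V_def by (intro compact_UN T U UN_mono order_refl)+
  have "open V" "K \<subseteq> V"
    using T U(1) by (auto simp: V_def)
  then obtain d where d: "d > 0" "(\<Union>x\<in>K. ball x d) \<subseteq> V"
    using compact_subset_open_imp_ball_epsilon_subset[OF K] by blast
  let ?f = "\<lambda>x. max 0 (2 - 2 / d * infdist x K)"
  have "x \<in> M" if "?f x \<noteq> 0" for x
  proof -
    have "0 < 2 - 2 / d * infdist x K"
      using that by (auto simp: max_def split: if_splits)
    then have "infdist x K < d"
      using d(1) by (simp add: field_simps)
    then obtain y where "y \<in> K" "dist x y < d"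
      using False by (auto simp: infdist_def cInf_less_iff)
    then have "x \<in> ball y d"
      by (simp add: dist_commute)
    then show ?thesis
      using d(2) M(2) \<open>y \<in> K\<close> by blast
  qed
  then have "closure {x. ?f x \<noteq> 0} \<subseteq> M"
    using M(1) by (intro closure_minimal compact_imp_closed) auto
  then have "compact (closure {x. ?f x \<noteq> 0})"
    using M(1) compact_Int_closed[OF M(1) closed_closure, of "{x. ?f x \<noteq> 0}"]
    by (simp add: Int_absorb1)
  moreover have "continuous_on UNIV ?f"
    by (intro continuous_intros)
  ultimately show ?thesis
    by (intro bexI[of _ ?f]) (auto simp: Cc_def)
qed

text \<open>An approximant within 1 of a function that is at least 2 on \<open>K\<close> is at least
  1 there; the unit contraction makes it exactly 1 on \<open>K\<close> and bounded.\<close>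

lemma regular_form_unit_on_compact:
  fixes K :: "'a::metric_space set"
  assumes lc: "locally_compact_space (euclidean :: 'a topology)"
    and E: "energy_form_L0 m E" and reg: "regular_form m E" and K: "compact K"
  shows "\<exists>f\<in>form_dom m E \<inter> Linf m. \<forall>x\<in>K. f x = 1"
proof -
  interpret energy_form_L0 m E by fact
  obtain f where f: "f \<in> Cc" "\<And>x. x \<in> K \<Longrightarrow> 2 \<le> f x"
    using exists_Cc_ge_on_compact[OF lc K] by blast
  have "\<exists>g\<in>D \<inter> Cc. \<forall>x. \<bar>g x - f x\<bar> < 1"
    using reg f(1) zero_less_one unfolding regular_form_def by blast
  then obtain g where g: "g \<in> D" "\<And>x. \<bar>g x - f x\<bar> < 1"
    by blast
  have "1 \<le> g x" if "x \<in> K" for x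
    using f(2)[OF that] g(2)[of x] by linarith
  then have "\<forall>x\<in>K. max 0 (min 1 (g x)) = 1"
    by simp
  moreover have "(\<lambda>x. max 0 (min 1 (g x))) \<in> D"
    using g(1) dom_L0[OF g(1)]
    by (intro dom_le[OF g(1)] E_unit_contraction) (simp_all add: L0_def)
  moreover from dom_L0[OF this] have "(\<lambda>x. max 0 (min 1 (g x))) \<in> Linf m"
    unfolding Linf_def by (auto intro!: exI[of _ 1])
  ultimately show ?thesis
    by (intro bexI[of _ "\<lambda>x. max 0 (min 1 (g x))"] IntI)
qed

lemma cap_top_boundary_eq_zero:
  fixes m :: "'a::metric_space measure"
  assumes E: "energy_form_L0 m E" and reg: "regular_form m E"
    and eq: "\<And>f. f \<in> L0 m \<Longrightarrow> E f = E' f" and h: "h \<in> form_dom m E"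
  shows "cap_top_boundary m E' h = 0"
proof -
  interpret energy_form_L0 m E by fact
  have "cap_top_boundary m E' h \<le> 0 + ennreal e" if e: "0 < e" for e
  proof -
    \<comment> \<open>Radius \<open>sqrt e\<close> in the seminorm means energy below
      \<open>e\<close> for the competitor \<open>h - g\<close>.\<close>
    let ?W = "{g \<in> D. sqrt (Q (\<lambda>x. g x - h x)) < sqrt e}"
    have W: "openin (form_topology m E) ?W"
      using e by (intro openin_seminorm_ball h) simp
    have hW: "h \<in> ?W"
      using h e Q_scale[OF h, of 0] by simp
    have "h \<in> form_topology m E closure_of (D \<inter> Cc)"
      using reg h by (simp add: regular_form_def)
    then have "\<exists>g. g \<in> D \<inter> Cc \<and> g \<in> ?W"
      unfolding in_closure_of by (elim conjE allE[of _ ?W] mp) (rule conjI[OF hW W])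
    then obtain g where g: "g \<in> ?W" "g \<in> D \<inter> Cc"
      by blast
    let ?K = "closure {x. g x \<noteq> 0}" and ?f = "\<lambda>x. h x - g x"
    have f: "?f \<in> D"
      using g(2) by (intro dom_diff[OF h]) (rule IntD1)
    have "h x * indicator (UNIV - ?K) x \<le> ?f x * indicator (UNIV - ?K) x" for x
    proof (cases "g x = 0")
      case False
      then have "x \<in> {x. g x \<noteq> 0}" by simp
      then have "x \<in> ?K" by (rule subsetD[OF closure_subset])
      then show ?thesis by simp
    qed simp
    then have "cap m E' h (UNIV - ?K) \<le> E' ?f"
      unfolding cap_def using dom_L0[OF f]
      by (intro Inf_lower CollectI exI[of _ ?f]) simp
    moreover have "compact ?K"
      using g by (simp add: Cc_def)
    then have "cap_top_boundary m E' h \<le> cap m E' h (UNIV - ?K)"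
      unfolding cap_top_boundary_def by (intro INF_lower CollectI)
    moreover have "E' ?f = E ?f"
      using eq[OF dom_L0[OF f]] by simp
    moreover have "E ?f \<le> ennreal e"
    proof -
      have "Q ?f < e"
        using g Q_minus_commute[OF _ h, of g] by simp
      then show ?thesis
        using E_le_iff[OF f, of e] e by simp
    qed
    ultimately show ?thesis by simp
  qed
  then show ?thesis
    using ennreal_le_epsilon[of 0 "cap_top_boundary m E' h"] by simp
qed

lemma cap_top_boundary_zeroE:
  assumes "cap_top_boundary m E h = 0" "0 < e"
  obtains K f where "compact K" "f \<in> L0 m" "E f < e" "AE x in m. x \<notin> K \<longrightarrow> h x \<le> f x"
proof -
  have "(INF K\<in>{K. compact K}. cap m E h (UNIV - K)) < e"
    using assms by (simp add: cap_top_boundary_def)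
  then obtain K where K: "compact K" "cap m E h (UNIV - K) < e"
    unfolding INF_less_iff by blast
  then obtain f where f: "f \<in> L0 m" "E f < e"
    "AE x in m. f x * indicator (UNIV - K) x \<ge> h x * indicator (UNIV - K) x"
    unfolding cap_def Inf_less_iff by blast
  have "AE x in m. x \<notin> K \<longrightarrow> h x \<le> f x"
    using f(3) by eventually_elim (auto simp: indicator_def)
  with K f that show ?thesis by blast
qed

section \<open>Comparison of the domains of \<open>E\<close> and \<open>E'\<close>\<close>

locale silverstein =
  base: energy_form_L0 m E + ext: energy_form_L0 m E'
  for m :: "'a::{metric_space, second_countable_topology} measure" and E E' +
  assumes lc: "locally_compact_space (euclidean :: 'a topology)"
    and regular: "regular_form m E"
    and silverstein: "silverstein_extension m E E'"
begin

lemma base_dom_subset: "base.D \<subseteq> ext.D"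
  using silverstein by (simp add: silverstein_extension_def extends_def)

lemma extension_eq: "u \<in> base.D \<Longrightarrow> E u = E' u"
  using silverstein by (simp add: silverstein_extension_def extends_def)

text \<open>Multiplying \<open>u\<close> by a bounded function in the domain of \<open>E\<close>
  that is 1 on \<open>K\<close> leaves it unchanged almost everywhere, so the ideal property
  applies.\<close>

lemma compact_support_dom:
  assumes u: "u \<in> ext.D" "u \<in> Linf m" and K: "compact K"
    and supp: "AE x in m. x \<notin> K \<longrightarrow> u x = 0"
  shows "u \<in> base.D"
proof -
  obtain f where f: "f \<in> base.D \<inter> Linf m" "\<And>x. x \<in> K \<Longrightarrow> f x = 1"
    using regular_form_unit_on_compact[OF lc base.energy_form_L0_axioms regular K] by blast
  have "(\<lambda>x. f x * u x) \<in> base.D"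
    using silverstein f(1) u by (auto simp: silverstein_extension_def)
  moreover have "AE x in m. f x * u x = u x"
    using supp by eventually_elim (use f(2) in auto)
  ultimately show ?thesis
    using u by (auto intro: base.dom_cong_AE dest: ext.dom_L0)
qed

text \<open>On the domain of \<open>E\<close> the two energies agree, so the bound holds for
  \<open>E\<close>; lower semicontinuity of \<open>E\<close> rather than \<open>E'\<close> puts the
  limit into the smaller domain.\<close>

lemma lsc_dom:
  assumes f: "\<And>n. f n \<in> base.D" "\<And>n. ext.Q (f n) \<le> c" and g: "g \<in> L0 m"
    and lim: "AE x in m. (\<lambda>n. f n x) \<longlonglongrightarrow> g x"
  shows "g \<in> base.D"
proof -
  have c: "0 \<le> c"
    using f(2)[of 0] enn2real_nonneg order_trans by blast
  have "E (f n) \<le> ennreal c" for n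
    using ext.E_le_iff[of "f n" c] f[of n] c base_dom_subset extension_eq[OF f(1)[of n]] by auto
  then have "E g \<le> ennreal c"
    using f by (intro base.lower_semicontinuous[OF base.dom_L0 g lim])
  then show ?thesis
    by (rule base.domI[OF g])
qed

lemma ext_dom_subset_base:
  assumes transient: "transient m E'" and h: "superharmonic m E' h" "AE x in m. 0 < h x"
    and cap: "cap_top_boundary m E' h = 0"
  shows "ext.D \<subseteq> base.D"
proof -
  have hD: "h \<in> ext.D"
    using h by (simp add: superharmonic_def)
  \<comment> \<open>Summable bounds keep the energies of all running minima below a common
    constant.\<close>
  have "\<exists>K f. compact K \<and> f \<in> L0 m \<and> E' f < ennreal ((1 / 4) ^ n) \<and>
      (AE x in m. x \<notin> K \<longrightarrow> h x \<le> f x)" for n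
  proof -
    have "0 < ennreal ((1 / 4) ^ n)" by simp
    from cap_top_boundary_zeroE[OF cap this] show ?thesis by blast
  qed
  then have "\<exists>K. \<forall>n. \<exists>f. compact (K n) \<and> f \<in> L0 m \<and> E' f < ennreal ((1 / 4) ^ n) \<and>
      (AE x in m. x \<notin> K n \<longrightarrow> h x \<le> f x)"
    by (intro choice allI)
  then obtain K where "\<forall>n. \<exists>f. compact (K n) \<and> f \<in> L0 m \<and> E' f < ennreal ((1 / 4) ^ n) \<and>
      (AE x in m. x \<notin> K n \<longrightarrow> h x \<le> f x)" ..
  then have "\<exists>f. \<forall>n. compact (K n) \<and> f n \<in> L0 m \<and> E' (f n) < ennreal ((1 / 4) ^ n) \<and>
      (AE x in m. x \<notin> K n \<longrightarrow> h x \<le> f n x)"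
    by (rule choice)
  then obtain f0 where K: "\<And>n. compact (K n)"
    and f0: "\<And>n. f0 n \<in> L0 m" "\<And>n. E' (f0 n) < ennreal ((1 / 4) ^ n)"
      "\<And>n. AE x in m. x \<notin> K n \<longrightarrow> h x \<le> f0 n x"
    by blast
  have f0D: "f0 n \<in> ext.D" "ext.Q (f0 n) \<le> (1 / 4) ^ n" for n
  proof -
    show "f0 n \<in> ext.D"
      using ext.domI[OF f0(1) less_imp_le[OF f0(2)]] .
    then show "ext.Q (f0 n) \<le> (1 / 4) ^ n"
      using less_imp_le[OF f0(2)[of n]] by (simp add: ext.E_le_iff)
  qed
  \<comment> \<open>Truncation at \<open>h\<close> provides a common majorant and the positive part
    a lower bound, both without raising the energy; off \<open>K n\<close> the domination of
    \<open>h\<close> survives.\<close>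
  define f where "f n x = max 0 (min (f0 n x) (h x))" for n x
  have fD: "f n \<in> ext.D" for n
    unfolding f_def by (intro ext.dom_pos_part ext.Q_min f0D hD)
  have fQ: "ext.Q (f n) \<le> (1 / 4) ^ n" for n
  proof -
    have "ext.Q (f n) \<le> ext.Q (\<lambda>x. min (f0 n x) (h x))"
      unfolding f_def by (intro ext.Q_le ext.E_pos_part ext.dom_L0 ext.Q_min f0D hD)
    also have "\<dots> \<le> ext.Q (f0 n)"
      by (intro ext.Q_min_superharmonic f0D h)
    also note f0D(2)
    finally show ?thesis .
  qed
  define w where "w = running_min f 0"
  have wD: "w j \<in> ext.D" and wQ: "ext.Q (w j) \<le> 2" for j
    using ext.running_min_dom[OF fD fQ, of 0 j] by (simp_all add: w_def)
  have w_lim: "AE x in m. (\<lambda>j. w j x) \<longlonglongrightarrow> 0"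
    unfolding w_def
    by (rule ext.running_min_tendsto_zero[OF fD fQ _ _ transient, where H = "\<lambda>x. max 0 (h x)"])
      (auto simp: f_def)
  \<comment> \<open>\<open>w j\<close> is the minimum of \<open>f 0\<close> up to
    \<open>f j\<close>, each of which dominates \<open>h\<close> off its own compact set.\<close>
  have w_ge: "AE x in m. x \<notin> (\<Union>k\<le>j. K k) \<longrightarrow> h x \<le> w j x" for j
  proof -
    have "AE x in m. \<forall>n. x \<notin> K n \<longrightarrow> h x \<le> f0 n x"
      using f0(3) by (simp add: AE_all_countable)
    then show ?thesis
    proof eventually_elim
      case (elim x)
      show ?case
      proof
        assume "x \<notin> (\<Union>k\<le>j. K k)"
        then have "h x \<le> f k x" if "k \<le> 0 + j" for k
          using elim that by (auto simp: f_def)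
        then show "h x \<le> w j x"
          unfolding w_def by (rule running_min_ge)
      qed
    qed
  qed
  have w_nonneg: "0 \<le> w j x" for j x
    unfolding w_def by (intro running_min_ge) (simp add: f_def)
  \<comment> \<open>The bound \<open>c\<close> keeps the approximants bounded; the bound
    \<open>c * h\<close> makes them vanish where \<open>w j\<close> dominates
    \<open>h\<close>.\<close>
  have bounded: "g \<in> base.D"
    if g: "g \<in> ext.D" "\<And>x. 0 \<le> g x" "\<And>x. g x \<le> c" "AE x in m. g x \<le> c * h x" and c: "0 < c" for g c
  proof (rule lsc_dom[where f = "\<lambda>j x. max 0 (g x - c * w j x)"])
    have d: "(\<lambda>x. g x - c * w j x) \<in> ext.D" for j
      by (intro ext.dom_diff ext.dom_scale g wD)
    fix j
    have p: "(\<lambda>x. max 0 (g x - c * w j x)) \<in> ext.D"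
      by (rule ext.dom_pos_part[OF d])
    show "(\<lambda>x. max 0 (g x - c * w j x)) \<in> base.D"
    proof (rule compact_support_dom[OF p])
      have "max 0 (g x - c * w j x) \<le> c" for x
        using g(3)[of x] c mult_nonneg_nonneg[OF less_imp_le[OF c] w_nonneg[of j x]] by linarith
      then show "(\<lambda>x. max 0 (g x - c * w j x)) \<in> Linf m"
        using ext.dom_L0[OF p] by (auto simp: Linf_def intro!: exI[of _ c])
      show "compact (\<Union>k\<le>j. K k)"
        using K by (intro compact_UN) auto
      show "AE x in m. x \<notin> (\<Union>k\<le>j. K k) \<longrightarrow> max 0 (g x - c * w j x) = 0"
        using w_ge[of j] g(4)
      proof eventually_elim
        case (elim x)
        show ?case
        proof
          assume "x \<notin> (\<Union>k\<le>j. K k)"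
          then have "c * h x \<le> c * w j x"
            using elim(1) c by (intro mult_left_mono) auto
          then show "max 0 (g x - c * w j x) = 0"
            using elim(2) by simp
        qed
      qed
    qed
    have "ext.Q (\<lambda>x. max 0 (g x - c * w j x)) \<le> ext.Q (\<lambda>x. g x - c * w j x)"
      by (intro ext.Q_le ext.E_pos_part ext.dom_L0 d)
    \<comment> \<open>The parallelogram law with the energy of the sum dropped; \<open>wQ\<close>
      then makes the bound uniform in \<open>j\<close>.\<close>
    also have "\<dots> \<le> 2 * ext.Q g + 2 * ext.Q (\<lambda>x. c * w j x)"
      unfolding ext.Q_parallelogram[OF g(1) ext.dom_scale[OF wD]] by simp
    also have "\<dots> \<le> 2 * ext.Q g + 2 * (c\<^sup>2 * 2)"
      unfolding ext.Q_scale[OF wD] using wQ by (intro add_mono mult_left_mono) auto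
    finally show "ext.Q (\<lambda>x. max 0 (g x - c * w j x)) \<le> 2 * ext.Q g + 2 * (c\<^sup>2 * 2)" .
  next
    show "AE x in m. (\<lambda>j. max 0 (g x - c * w j x)) \<longlonglongrightarrow> g x"
      using w_lim
    proof eventually_elim
      case (elim x)
      then have "(\<lambda>j. max 0 (g x - c * w j x)) \<longlonglongrightarrow> max 0 (g x - c * 0)"
        by (intro tendsto_intros)
      then show ?case
        using g(2)[of x] by simp
    qed
  qed (rule ext.dom_L0[OF g(1)])
  have nonneg: "g \<in> base.D" if g: "g \<in> ext.D" "\<And>x. 0 \<le> g x" for g
  proof -
    define c where "c n = real (Suc n)" for n
    have c: "0 < c n" for n
      by (simp add: c_def)
    define p where "p n x = max 0 (min (c n) (g x))" for n x
    \<comment> \<open>The two truncations match the two bounds required by \<open>bounded\<close>.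
      On the null set where \<open>h\<close> is not positive \<open>q n\<close> may be negative,
      hence the positive part below.\<close>
    define q where "q n x = min (p n x) (c n * h x)" for n x
    have E_p: "E' (p n) \<le> E' g" for n
      unfolding p_def by (rule ext.E_interval_contraction[OF ext.dom_L0[OF g(1)] c])
    have p: "p n \<in> ext.D" for n
      using ext.dom_L0[OF g(1)]
      by (intro ext.dom_le[OF g(1) _ E_p]) (simp add: p_def[abs_def] L0_def)
    have q: "q n \<in> ext.D" "ext.Q (q n) \<le> ext.Q (p n)" for n
      unfolding q_def using ext.Q_min_scale_superharmonic[OF p h(1) c] .
    have s: "(\<lambda>x. max 0 (q n x)) \<in> ext.D" for n
      by (rule ext.dom_pos_part[OF q(1)])
    show ?thesis
    proof (rule lsc_dom[where f = "\<lambda>n x. max 0 (q n x)"])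
      show "(\<lambda>x. max 0 (q n x)) \<in> base.D" for n
      proof (rule bounded[OF s _ _ _ c])
        show "max 0 (q n x) \<le> c n" for x
          using c[of n] by (auto simp: q_def p_def)
        show "AE x in m. max 0 (q n x) \<le> c n * h x"
          using h(2) by eventually_elim (use c[of n] in \<open>simp add: q_def\<close>)
      qed simp
      show "ext.Q (\<lambda>x. max 0 (q n x)) \<le> ext.Q g" for n
        using ext.Q_le[OF q(1) ext.E_pos_part[OF ext.dom_L0[OF q(1)[of n]]]] q(2)[of n]
          ext.Q_le[OF g(1) E_p[of n]] by linarith
      show "AE x in m. (\<lambda>n. max 0 (q n x)) \<longlonglongrightarrow> g x"
        using h(2)
      proof eventually_elim
        case (elim x)
        \<comment> \<open>From \<open>N\<close> on neither truncation is active at \<open>x\<close>,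
          so the sequence is eventually constant.\<close>
        obtain N where N: "max (g x) (g x / h x) \<le> real N"
          using real_arch_simple by blast
        have "max 0 (q n x) = g x" if "n \<ge> N" for n
        proof -
          have "g x \<le> c n" "g x / h x \<le> c n"
            using N that by (auto simp: c_def)
          then have "g x \<le> c n" "g x \<le> c n * h x"
            using elim by (auto simp: divide_le_eq)
          then show ?thesis
            using g(2)[of x] by (simp add: q_def p_def)
        qed
        then show ?case
          by (intro tendsto_eventually eventually_sequentiallyI)
      qed
    qed (rule ext.dom_L0[OF g(1)])
  qed
  show ?thesis
  proof
    fix g assume g: "g \<in> ext.D"
    have "(\<lambda>x. max 0 (g x) - max 0 (- g x)) \<in> base.D"
      by (intro base.dom_diff nonneg ext.dom_pos_part ext.dom_neg_part g) auto
    moreover have "(\<lambda>x. max 0 (g x) - max 0 (- g x)) = g"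
      by (auto simp: fun_eq_iff)
    ultimately show "g \<in> base.D" by simp
  qed
qed

end

theorem theorem3p30:
  fixes m :: "'a::{metric_space, second_countable_topology} measure"
    and E E' :: "('a \<Rightarrow> real) \<Rightarrow> ennreal"
    and h :: "'a \<Rightarrow> real"
  assumes "locally_compact_space (euclidean :: 'a topology)"
    and "radon_measure m" and "full_support m"
    and "energy_form m E" and "regular_form m E"
    and "silverstein_extension m E E'" and "transient m E'"
    and "superharmonic m E' h" and "AE x in m. 0 < h x"
  shows "(\<forall>f\<in>L0 m. E f = E' f) \<longleftrightarrow> cap_top_boundary m E' h = 0"
proof -
  have "energy_form m E'"
    using assms(6) by (simp add: silverstein_extension_def)
  then interpret silverstein m E E'
    using assms by (intro silverstein.intro silverstein_axioms.intro energy_form_L0_radon)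
  have h: "h \<in> ext.D"
    using assms(8) by (simp add: superharmonic_def)
  show ?thesis
  proof
    assume eq: "\<forall>f\<in>L0 m. E f = E' f"
    then have "h \<in> base.D"
      using h by (simp add: form_dom_def)
    with eq show "cap_top_boundary m E' h = 0"
      by (intro cap_top_boundary_eq_zero[OF base.energy_form_L0_axioms assms(5)]) auto
  next
    assume "cap_top_boundary m E' h = 0"
    then have "ext.D \<subseteq> base.D"
      by (rule ext_dom_subset_base[OF assms(7-9)])
    \<comment> \<open>Outside the domain of \<open>E\<close>, which now contains that of
      \<open>E'\<close>, both forms are infinite.\<close>
    then have "E f = E' f" if "f \<in> L0 m" "f \<notin> base.D" for f
      using that by (auto simp: form_dom_def top.not_eq_extremum[symmetric])
    with extension_eq show "\<forall>f\<in>L0 m. E f = E' f"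
      by blast
  qed
qed

end
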